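(* Let $1/2<\alpha<1$. Let $x_0\in(0,\pi)$ be such that, for some constant $d_0>0$, $|\sin(kx_0)|\ge d_0k^{-1}$ for all integers $k\ge1$. Let $T>0$, let $B\subset[0,T]$ be a Lebesgue-measurable set of positive Lebesgue measure, and let $m>0$. Then there exists a constant $C>0$, that can depend only on $B$, $x_0$, $\alpha$ and $m$, so that, for any $f\in H^2((0,\pi))$ with $\|f\|_{H^2((0,\pi))}\le m$, $$\|f\|_{L^2((0,\pi))}\le C\left(\left|\ln\|u_f^\alpha(x_0,\cdot)\|_{L^\infty(B)}\right|^{-1}+\|u_f^\alpha(x_0,\cdot)\|_{L^\infty(B)}\right),$$ where $u_f^\alpha$ is the solution of the fractional heat equation $(\partial_t+A^\alpha)u=0$ in $(0,+\infty)$, $u(\cdot,0)=f$.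
   Context: For $f\in L^2((0,\pi))$, $\widehat f_k=\frac2\pi\int_0^\pi f(x)\sin(kx)\,dx$. $A^\alpha$ is the fractional power of $A=-\partial_x^2$ on $(0,\pi)$ under the Dirichlet boundary condition: $A^\alpha f=\sum_{k\ge1}k^{2\alpha}\widehat f_k\sin(kx)$ with domain $D(A^\alpha)=\{f\in L^2((0,\pi)):\ \sum_{k\ge1}k^{4\alpha}|\widehat f_k|^2<\infty\}$. The solution is $u_f^\alpha(x,t)=\sum_{k\ge1}e^{-k^{2\alpha}t}\widehat f_k\sin(kx)$. For $\theta\ge0$ the paper uses the notation $H^\theta((0,\pi))=\{h\in L^2((0,\pi)):\ \sum_{k\ge1}\langle k\rangle^{2\theta}|\widehat h_k|^2<\infty\}$ (defined by sine coefficients), with norm $\|h\|_{H^\theta((0,\pi))}=\left(\sum_{k\ge1}\langle k\rangle^{2\theta}|\widehat h_k|^2\right)^{1/2}$, where $\langle k\rangle=(1+k^2)^{1/2}$. Convention: $|\ln y|^{-1}$ is read as $0$ when $y=0$ and as $+\infty$ when $y=1$. *)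

theory Defs
  imports "HOL-Analysis.Analysis" "HOL-Probability.Essential_Supremum"
begin

text \<open>
  Functions are complex-valued, which contains the real-valued case through the isometric
  embedding of the reals. Elements of $L^2$ are represented by Lebesgue measurable functions;
  all notions below are invariant under changes on null sets and on the complement of the domain.
\<close>

definition square_integrable_on :: "real set \<Rightarrow> (real \<Rightarrow> complex) \<Rightarrow> bool" where
  "square_integrable_on S f \<longleftrightarrow>
     f \<in> borel_measurable (lebesgue_on S) \<and> integrable (lebesgue_on S) (\<lambda>x. (norm (f x))\<^sup>2)"

definition L2_norm_on :: "real set \<Rightarrow> (real \<Rightarrow> complex) \<Rightarrow> real" where
  "L2_norm_on S f = sqrt (LINT x|lebesgue_on S. (norm (f x))\<^sup>2)"

definition Linf_norm_on :: "real set \<Rightarrow> (real \<Rightarrow> complex) \<Rightarrow> ennreal" where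
  "Linf_norm_on S g = esssup (lebesgue_on S) (\<lambda>t. ennreal (norm (g t)))"

definition sine_coeff :: "(real \<Rightarrow> complex) \<Rightarrow> nat \<Rightarrow> complex" where
  "sine_coeff f k =
     of_real (2 / pi) * (LINT x|lebesgue_on {0<..<pi}. f x * of_real (sin (real k * x)))"

definition japanese_bracket :: "real \<Rightarrow> real" where
  "japanese_bracket y = sqrt (1 + y\<^sup>2)"

definition sine_sobolev :: "real \<Rightarrow> (real \<Rightarrow> complex) set" where
  "sine_sobolev \<theta> = {h. square_integrable_on {0<..<pi} h \<and>
     (\<lambda>k. japanese_bracket (real k) powr (2 * \<theta>) * (norm (sine_coeff h k))\<^sup>2) summable_on {1..}}"

definition sine_sobolev_norm :: "real \<Rightarrow> (real \<Rightarrow> complex) \<Rightarrow> real" where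
  "sine_sobolev_norm \<theta> h =
     sqrt (\<Sum>\<^sub>\<infinity>k\<in>{1..}. japanese_bracket (real k) powr (2 * \<theta>) * (norm (sine_coeff h k))\<^sup>2)"

text \<open>
  The solution of $(\partial_t + A^\alpha)u = 0$, $u(\cdot,0) = f$, where $A = -\partial_x^2$ on
  $(0,\pi)$ with the Dirichlet condition and $A^\alpha$ multiplies the $k$-th sine coefficient
  by $k^{2\alpha}$. The series converges absolutely for $t > 0$, and also for $t = 0$ when
  the sine coefficients of $f$ are absolutely summable.
\<close>

definition frac_heat_solution :: "real \<Rightarrow> (real \<Rightarrow> complex) \<Rightarrow> real \<Rightarrow> real \<Rightarrow> complex" where
  "frac_heat_solution \<alpha> f x t =
     (\<Sum>\<^sub>\<infinity>k\<in>{1..}. of_real (exp (- (real k powr (2 * \<alpha>)) * t)) * sine_coeff f k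
        * of_real (sin (real k * x)))"

text \<open>
  $|\ln y|^{-1}$ on the extended half-line, equal to $0$ at $y = 0$ and at $y = \infty$. At
  $y = 1$ it is $\infty$, because \<^term>\<open>inverse (0::ennreal) = \<infinity>\<close>.
\<close>

definition inverse_abs_ln :: "ennreal \<Rightarrow> ennreal" where
  "inverse_abs_ln y =
     (if y = 0 \<or> y = \<infinity> then 0 else inverse (ennreal \<bar>ln (enn2real y)\<bar>))"

end

theory Submission
  imports Defs "HOL-Computational_Algebra.Polynomial" "HOL-Real_Asymp.Real_Asymp"
begin

text \<open>
  At \<open>x0\<close> the solution is an exponential sum \<open>g t = (\<Sum>k. A k * exp (- l k * t))\<close> with
  \<open>l k = k powr (2 * \<alpha>)\<close>, where \<open>A k\<close> is the sine coefficient of \<open>f\<close> times \<open>sin (k * x0)\<close>.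
  Interpolating each mode at \<open>n + 1\<close> well separated points of \<open>B\<close> near some \<open>a > 0\<close> costs a
  factor \<open>K ^ n\<close> and leaves an error \<open>2 ^ (- n)\<close>, so smallness of \<open>g\<close> on \<open>B\<close> propagates to an
  interval. There the \<open>k\<close>-th mode is isolated by composing the operators
  \<open>exp (- l j * \<tau> j) - Shift (\<tau> j)\<close> for all \<open>j \<noteq> k\<close>, with shifts \<open>\<tau> j\<close> proportional to \<open>j powr (- p)\<close>
  and \<open>1 < p < 2 * \<alpha>\<close>: the total shift is finite, the product of the operator norms converges, and
  the multiplier of the \<open>k\<close>-th mode is at least \<open>exp (- D * k\<^sup>2)\<close>. Hence the first \<open>N\<close> sine
  coefficients are controlled up to a factor \<open>exp (b * N\<^sup>2)\<close>, the others contribute \<open>N powr (- 2)\<close>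
  by the Sobolev bound, and \<open>N\<^sup>2\<close> is taken proportional to the logarithm of the data.
\<close>

section \<open>Interpolation of exponentials\<close>

text \<open>The obstacle is uniformity over infinitely many modes with unbounded rates
  \<open>l k\<close>. For the interpolation it disappears because
  \<open>r ^ n * exp (- r * a) / fact n\<close> is at most \<open>1 / a ^ n\<close> whatever the
  rate \<open>r\<close> is: hence the nodes must stay away from time 0, and
  \<open>h \<le> a / 2\<close> makes the error \<open>2 ^ (- n)\<close> for all modes at once. For
  the isolation of a mode it disappears because the filters never enlarge a mode, so a limit of
  finite products suffices. The condition \<open>1 / 2 < \<alpha>\<close> leaves room for
  \<open>p\<close> between 1 (finite total shift) and \<open>2 * \<alpha>\<close>
  (\<open>l j * \<tau> j\<close> tends to infinity). The exponent \<open>D * k\<^sup>2\<close> is a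
  common majorant of all losses: \<open>exp (l k * a)\<close>, about \<open>2 * k\<close> small
  factors of order \<open>k powr (- 2)\<close>, and the division by \<open>sin (k * x0)\<close>,
  which costs only a factor of order \<open>k\<close>. The square also fits Sobolev order 2: with
  \<open>N\<^sup>2\<close> of the order of \<open>\<bar>ln \<epsilon>\<bar>\<close>, the tail
  \<open>N powr (- 2)\<close> is of the order of \<open>1 / \<bar>ln \<epsilon>\<bar>\<close>, to
  the first power.\<close>

lemma Rolle_finite_zeros:
  fixes f f' :: "real \<Rightarrow> real"
  assumes der: "\<And>x. (f has_real_derivative f' x) (at x)"
    and "finite Z" "card Z = Suc k" "Z \<subseteq> {a..b}" "\<And>z. z \<in> Z \<Longrightarrow> f z = 0"
  shows "\<exists>Z'. finite Z' \<and> card Z' = k \<and> Z' \<subseteq> {a..<Max Z} \<and> (\<forall>z\<in>Z'. f' z = 0)"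
  using assms(2-)
proof (induction k arbitrary: Z)
  case 0
  show ?case by (rule exI[of _ "{}"]) auto
next
  case (Suc k)
  \<comment> \<open>The strict bound by \<open>Max Z\<close> in the conclusion carries the
    induction: the zeros obtained for \<open>Y\<close> lie left of \<open>Max Y\<close>, while the
    new one lies strictly between \<open>Max Y\<close> and \<open>M\<close>, so it is distinct from
    them.\<close>
  define M where "M = Max Z"
  define Y where "Y = Z - {M}"
  have "Z \<noteq> {}" using Suc.prems by auto
  then have M: "M \<in> Z" using Suc.prems by (simp add: M_def)
  have Y: "finite Y" "card Y = Suc k" "Y \<subseteq> {a..b}" "\<And>z. z \<in> Y \<Longrightarrow> f z = 0"
    using Suc.prems M by (auto simp: Y_def)
  then obtain Z' where Z': "finite Z'" "card Z' = k" "Z' \<subseteq> {a..<Max Y}" "\<forall>z\<in>Z'. f' z = 0"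
    using Suc.IH[of Y] by blast
  have "Y \<noteq> {}" using Y by auto
  then have MY: "Max Y \<in> Y" using Y by simp
  have "Y \<subseteq> Z" "M \<notin> Y" by (auto simp: Y_def)
  then have "Max Y \<noteq> M" "Max Y \<in> Z" using MY by (metis, blast)
  then have lt: "Max Y < M"
    using Max_ge[of Z "Max Y"] Suc.prems unfolding M_def by linarith
  obtain z where z: "Max Y < z" "z < M" "f M - f (Max Y) = (M - Max Y) * f' z"
    using MVT2[OF lt, of f f'] der by blast
  have "f M = 0" "f (Max Y) = 0" using M MY Suc.prems(4) Y(4) by blast+
  then have "f' z = 0" using z(3) lt by simp
  moreover have "z \<notin> Z'" using Z'(3) z(1) by auto
  moreover have "z \<in> {a..<M}" using MY Y(3) z by auto
  moreover have "Z' \<subseteq> {a..<M}" using Z'(3) lt by auto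
  ultimately show ?case
    using Z'(1,2,4) unfolding M_def[symmetric]
    by (intro exI[of _ "insert z Z'"]) simp
qed

lemma Rolle_iterated:
  fixes F :: "nat \<Rightarrow> real \<Rightarrow> real"
  assumes "\<And>i x. (F i has_real_derivative F (Suc i) x) (at x)"
    and "finite Z" "card Z = Suc n" "Z \<subseteq> {a..b}" "\<And>z. z \<in> Z \<Longrightarrow> F 0 z = 0"
  shows "\<exists>x\<in>{a..b}. F n x = 0"
  using assms
proof (induction n arbitrary: F Z)
  case 0
  from \<open>card Z = Suc 0\<close> obtain z where "Z = {z}" by (auto simp: card_Suc_eq)
  with 0 show ?case by auto
next
  case (Suc n)
  have "\<exists>Z'. finite Z' \<and> card Z' = Suc n \<and> Z' \<subseteq> {a..<Max Z} \<and> (\<forall>z\<in>Z'. F (Suc 0) z = 0)"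
    by (rule Rolle_finite_zeros[OF Suc.prems(1) Suc.prems(2-5)])
  then obtain Z' where Z': "finite Z'" "card Z' = Suc n" "Z' \<subseteq> {a..<Max Z}"
      "\<And>z. z \<in> Z' \<Longrightarrow> F (Suc 0) z = 0"
    by blast
  have "Z \<noteq> {}" using Suc.prems(3) by auto
  then have "Max Z \<in> {a..b}" using Suc.prems(2,4) Max_in by blast
  then have Z'_sub: "Z' \<subseteq> {a..b}"
    using order.trans[OF Z'(3), of "{a..b}"] by (simp add: atLeastLessThan_subseteq_atLeastAtMost_iff)
  show ?case
    by (rule Suc.IH[of "\<lambda>i. F (Suc i)" Z', OF Suc.prems(1) Z'(1,2) Z'_sub Z'(4)])
qed

section \<open>Lagrange interpolation and its remainder\<close>

lemma higher_pderiv_degree: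
  fixes p :: "real poly"
  assumes "degree p \<le> n"
  shows "(pderiv ^^ n) p = [:fact n * coeff p n:]"
  using assms
proof (induction n arbitrary: p)
  case 0
  then obtain c where "p = [:c:]" by (auto elim: degree_eq_zeroE)
  then show ?case by simp
next
  case (Suc n)
  have "degree (pderiv p) \<le> n" using Suc.prems by (simp add: degree_pderiv)
  then show ?case
    using Suc.IH[of "pderiv p"] by (simp add: funpow_Suc_right coeff_pderiv del: funpow.simps)
qed

definition lagrange_basis :: "(nat \<Rightarrow> real) \<Rightarrow> nat \<Rightarrow> nat \<Rightarrow> real poly" where
  "lagrange_basis t n i = (\<Prod>j\<in>{..n} - {i}. smult (1 / (t i - t j)) [:- t j, 1:])"

lemma poly_lagrange_basis:
  "poly (lagrange_basis t n i) x = (\<Prod>j\<in>{..n} - {i}. (x - t j) / (t i - t j))"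
  by (simp add: lagrange_basis_def poly_prod diff_divide_distrib)

lemma degree_lagrange_basis:
  assumes "i \<le> n" shows "degree (lagrange_basis t n i) \<le> n"
proof -
  have "degree (lagrange_basis t n i) \<le> (\<Sum>j\<in>{..n} - {i}. degree (smult (1 / (t i - t j)) [:- t j, 1:]))"
    unfolding lagrange_basis_def
    by (rule order.trans[OF degree_prod_sum_le]) (simp_all only: o_def finite_Diff finite_atMost order.refl)
  also have "\<dots> \<le> (\<Sum>j\<in>{..n} - {i}. degree [:- t j, 1:])"
    by (intro sum_mono degree_smult_le)
  also have "\<dots> = (\<Sum>j\<in>{..n} - {i}. 1)"
    by simp
  finally have "degree (lagrange_basis t n i) \<le> (\<Sum>j\<in>{..n} - {i}. 1)" .
  then show ?thesis using assms by simp
qed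

lemma lagrange_basis_node:
  assumes "inj_on t {..n}" "i \<le> n" "k \<le> n"
  shows "poly (lagrange_basis t n i) (t k) = (if i = k then 1 else 0)"
proof (cases "i = k")
  case True
  have "t k \<noteq> t j" if "j \<in> {..n} - {k}" for j
    using that assms by (auto dest: inj_onD)
  then show ?thesis using True by (simp add: poly_lagrange_basis)
next
  case False
  then have "k \<in> {..n} - {i}" using assms by auto
  then have "(\<Prod>j\<in>{..n} - {i}. (t k - t j) / (t i - t j)) = 0"
    by (intro prod_zero) auto
  then show ?thesis using False by (simp add: poly_lagrange_basis)
qed

lemma monic_prod_linear:
  fixes t :: "nat \<Rightarrow> real"
  shows "degree (\<Prod>i\<le>n. [:- t i, 1:]) = Suc n \<and> lead_coeff (\<Prod>i\<le>n. [:- t i, 1:]) = 1"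
proof
  show "degree (\<Prod>i\<le>n. [:- t i, 1:]) = Suc n"
    by (subst degree_prod_sum_eq) auto
  show "lead_coeff (\<Prod>i\<le>n. [:- t i, 1:]) = 1"
    by (simp add: lead_coeff_prod)
qed

text \<open>One term of the exponential series. It serves twice: to cancel the rate in the
  interpolation error, and in place of Stirling's formula for
  \<open>Suc n ^ n / fact n\<close>.\<close>

lemma power_div_fact_le_exp:
  fixes x :: real
  assumes "0 \<le> x"
  shows "x ^ n / fact n \<le> exp x"
proof -
  have "(\<Sum>i\<in>{n}. x ^ i /\<^sub>R fact i) \<le> (\<Sum>i. x ^ i /\<^sub>R fact i)"
    using assms by (intro sum_le_suminf summable_exp_generic) auto
  then show ?thesis by (simp add: exp_def divide_inverse mult.commute)
qed

text \<open>Classical remainder formula: the derivative of order \<open>n + 1\<close> at some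
  \<open>\<xi>\<close>, over \<open>fact (Suc n)\<close>, times the product of the
  \<open>x - t i\<close>. Here the derivative has modulus
  \<open>r ^ Suc n * exp (- r * \<xi>)\<close> with \<open>\<xi> \<ge> a\<close>, and
  \<open>(r * a) ^ Suc n / fact (Suc n) \<le> exp (r * a)\<close> removes \<open>r\<close> from the
  bound.\<close>

lemma exp_interpolation_error:
  fixes a h r x :: real
  assumes "0 < a" "0 \<le> r" and inj: "inj_on t {..n}"
    and t: "t ` {..n} \<subseteq> {a..a+h}" and x: "x \<in> {a..a+h}"
  shows "\<bar>exp (- r * x) - (\<Sum>i\<le>n. exp (- r * t i) * poly (lagrange_basis t n i) x)\<bar> \<le> (h / a) ^ Suc n"
proof -
  define P where "P = (\<Sum>i\<le>n. smult (exp (- r * t i)) (lagrange_basis t n i))"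
  define W where "W = (\<Prod>i\<le>n. [:- t i, 1:])"
  have h: "h \<ge> 0" using x by auto
  have P: "poly P y = (\<Sum>i\<le>n. exp (- r * t i) * poly (lagrange_basis t n i) y)" for y
    by (simp add: P_def poly_sum)
  have Pnode: "poly P (t k) = exp (- r * t k)" if "k \<le> n" for k
  proof -
    have "poly P (t k) = (\<Sum>i\<le>n. if i = k then exp (- r * t k) else 0)"
      unfolding P using lagrange_basis_node[OF inj _ that] by (intro sum.cong) auto
    then show ?thesis using that by simp
  qed
  have dP: "degree P \<le> n"
    unfolding P_def
    by (intro degree_sum_le order.trans[OF degree_smult_le degree_lagrange_basis]) auto
  have W: "poly W y = (\<Prod>i\<le>n. y - t i)" for y
    by (simp add: W_def poly_prod)
  show ?thesis
  proof (cases "x \<in> t ` {..n}")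
    case True
    then have "exp (- r * x) - poly P x = 0" using Pnode by auto
    then show ?thesis unfolding P using h assms(1) by (simp del: power_Suc)
  next
    case False
    then have Wx: "poly W x \<noteq> 0" unfolding W by auto
    \<comment> \<open>\<open>K\<close> makes \<open>Q\<close> agree with the exponential at
      \<open>x\<close> too, so \<open>F 0\<close> has \<open>n + 2\<close> zeros. As
      \<open>W\<close> is monic of degree \<open>n + 1\<close> and \<open>degree P \<le> n\<close>,
      the derivative of order \<open>n + 1\<close> of \<open>Q\<close> is the constant
      \<open>K * fact (Suc n)\<close>, which determines \<open>K\<close>.\<close>
    define K where "K = (exp (- r * x) - poly P x) / poly W x"
    define Q where "Q = P + smult K W"
    define F where "F i y = (- r) ^ i * exp (- r * y) - poly ((pderiv ^^ i) Q) y" for i y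
    have der: "(F i has_real_derivative F (Suc i) y) (at y)" for i y
    proof -
      have "((\<lambda>y. (- r) ^ i * exp (- r * y)) has_real_derivative (- r) ^ i * (exp (- r * y) * (- r * 1))) (at y)"
        by (intro derivative_intros DERIV_fun_exp DERIV_cmult DERIV_ident)
      from DERIV_diff[OF this poly_DERIV[of "(pderiv ^^ i) Q" y]]
      show ?thesis unfolding F_def by (simp add: mult_ac)
    qed
    have zero: "F 0 z = 0" if "z \<in> insert x (t ` {..n})" for z
    proof (cases "z = x")
      case True
      then show ?thesis using Wx by (simp add: F_def Q_def K_def)
    next
      case False
      with that have "z \<in> t ` {..n}" by simp
      then obtain k where k: "k \<le> n" "z = t k" by auto
      then have "poly W z = 0" unfolding W by auto
      then show ?thesis using k Pnode by (simp add: F_def Q_def)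
    qed
    have "card (insert x (t ` {..n})) = Suc (Suc n)"
      using False card_image[OF inj] by (simp add: card_insert_if)
    then obtain \<xi> where \<xi>: "\<xi> \<in> {a..a+h}" "F (Suc n) \<xi> = 0"
      using Rolle_iterated[of F "insert x (t ` {..n})" "Suc n" a "a+h"] der zero t x by auto
    have dQ: "degree Q \<le> Suc n" "coeff Q (Suc n) = K"
      using dP monic_prod_linear[of t n] unfolding W_def[symmetric] Q_def
      by (auto intro!: degree_add_le order.trans[OF degree_smult_le] simp: coeff_eq_0)
    have "K * fact (Suc n) = (- r) ^ Suc n * exp (- r * \<xi>)"
    proof -
      have "(- r) ^ Suc n * exp (- r * \<xi>) - poly [:fact (Suc n) * K:] \<xi> = 0"
        using \<xi>(2) unfolding F_def higher_pderiv_degree[OF dQ(1)] dQ(2) .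
      then show ?thesis by (simp add: mult.commute del: fact_Suc power_Suc)
    qed
    then have K: "K = (- r) ^ Suc n * exp (- r * \<xi>) / fact (Suc n)"
      by (metis fact_nonzero nonzero_mult_div_cancel_right)
    have "(r * a) ^ Suc n / fact (Suc n) \<le> exp (r * a)"
      using assms by (intro power_div_fact_le_exp) simp
    then have "(r * a) ^ Suc n / fact (Suc n) * exp (- (r * a)) \<le> exp (r * a) * exp (- (r * a))"
      by (intro mult_right_mono) auto
    also have "\<dots> = 1" by (simp flip: exp_add)
    finally have fac: "r ^ Suc n / fact (Suc n) * exp (- r * a) \<le> 1 / a ^ Suc n"
      using assms(1) unfolding power_mult_distrib by (simp add: pos_le_divide_eq mult_ac del: power_Suc fact_Suc)
    have "\<bar>K\<bar> = r ^ Suc n / fact (Suc n) * exp (- r * \<xi>)"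
      using assms by (simp add: K abs_mult power_abs del: power_Suc fact_Suc)
    also have "\<dots> \<le> r ^ Suc n / fact (Suc n) * exp (- r * a)"
      using \<xi>(1) assms by (intro mult_left_mono) (auto intro!: mult_left_mono divide_nonneg_pos)
    finally have absK: "\<bar>K\<bar> \<le> 1 / a ^ Suc n" using fac by linarith
    have "\<bar>poly W x\<bar> = (\<Prod>i\<le>n. \<bar>x - t i\<bar>)" by (simp add: W abs_prod)
    also have "\<dots> \<le> (\<Prod>i\<le>n. h)"
    proof (intro prod_mono conjI)
      fix i assume "i \<in> {..n}"
      then have "t i \<in> {a..a+h}" using t by blast
      then show "\<bar>x - t i\<bar> \<le> h" using x by auto
    qed auto
    finally have absW: "\<bar>poly W x\<bar> \<le> h ^ Suc n" by simp
    have "\<bar>exp (- r * x) - poly P x\<bar> = \<bar>K\<bar> * \<bar>poly W x\<bar>"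
      using Wx by (simp add: K_def)
    also have "\<dots> \<le> 1 / a ^ Suc n * h ^ Suc n"
      using absK absW assms(1) by (intro mult_mono) auto
    finally show ?thesis unfolding P by (simp add: power_divide)
  qed
qed

text \<open>Greedy choice from the right: take a point close to the supremum, keep only what lies at
  least \<open>\<eta>\<close> to its left, and continue; each round loses little more than
  \<open>\<eta>\<close> of measure. All pairs are compared, not only neighbours, because the
  Lagrange denominators involve all of them.\<close>

lemma spaced_points:
  fixes B :: "real set"
  assumes "bounded B" "B \<in> sets lebesgue" "0 \<le> \<eta>" "real k * \<eta> < measure lebesgue B"
  shows "\<exists>t. (\<forall>i\<le>k. t i \<in> B) \<and> (\<forall>i\<le>k. \<forall>j<i. real (i - j) * \<eta> \<le> t i - t j)"
  using assms
proof (induction k arbitrary: B)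
  case 0
  then have "B \<noteq> {}" by auto
  then obtain b where "b \<in> B" by auto
  then show ?case by (intro exI[of _ "\<lambda>_. b"]) auto
next
  case (Suc k)
  \<comment> \<open>The measure in excess of \<open>k + 1\<close> gaps. Spending at most half of it
    on the distance from \<open>b\<close> to \<open>Sup B\<close> leaves more than
    \<open>real k * \<eta>\<close> for the induction.\<close>
  define s where "s = measure lebesgue B - real (Suc k) * \<eta>"
  have s: "s > 0" using Suc.prems by (simp add: s_def)
  have "0 \<le> real (Suc k) * \<eta>" using Suc.prems(3) by simp
  then have Bne: "B \<noteq> {}" using Suc.prems(4) by (auto simp del: of_nat_Suc)
  have bdd: "bdd_above B" using Suc.prems(1) by (simp add: bounded_imp_bdd_above)
  obtain b where b: "b \<in> B" "Sup B - s / 2 < b"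
    using less_cSup_iff[OF Bne bdd, of "Sup B - s / 2"] s by auto
  define B' where "B' = B \<inter> {..b - \<eta>}"
  have B'_sets: "B' \<in> sets lebesgue" using Suc.prems(2) by (auto simp: B'_def)
  have B'_bdd: "bounded B'" using Suc.prems(1) by (auto simp: B'_def intro: bounded_subset)
  have lm: "B \<in> lmeasurable" "B' \<in> lmeasurable"
    using Suc.prems(1,2) B'_sets B'_bdd by (auto intro: bounded_set_imp_lmeasurable)
  have "B \<subseteq> B' \<union> {b - \<eta>..Sup B}"
    using cSup_upper[OF _ bdd] by (auto simp: B'_def)
  then have "measure lebesgue B \<le> measure lebesgue (B' \<union> {b - \<eta>..Sup B})"
    using lm Suc.prems(2) by (intro measure_mono_fmeasurable) auto
  also have "\<dots> \<le> measure lebesgue B' + measure lebesgue {b - \<eta>..Sup B}"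
    using lm by (intro measure_Un_le) auto
  also have "measure lebesgue {b - \<eta>..Sup B} = Sup B - b + \<eta>"
    using cSup_upper[OF b(1) bdd] Suc.prems(3) by simp
  finally have "real k * \<eta> < measure lebesgue B'"
    using b(2) s unfolding s_def of_nat_Suc by argo
  then obtain t where t: "\<forall>i\<le>k. t i \<in> B'" "\<forall>i\<le>k. \<forall>j<i. real (i - j) * \<eta> \<le> t i - t j"
    using Suc.IH[OF B'_bdd B'_sets Suc.prems(3)] by blast
  define u where "u i = (if i \<le> k then t i else b)" for i
  have "real (i - j) * \<eta> \<le> u i - u j" if "i \<le> Suc k" "j < i" for i j
  proof (cases "i \<le> k")
    case True
    then show ?thesis using t that by (simp add: u_def)
  next
    case False
    then have i: "i = Suc k" using that by simp
    then have j: "j \<le> k" using that by simp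
    have "real (k - j) * \<eta> \<le> t k - t j"
      using t(2) j by (cases "j = k") auto
    moreover have "t k \<le> b - \<eta>" using t(1) by (auto simp: B'_def)
    moreover have "real (i - j) * \<eta> = real (k - j) * \<eta> + \<eta>"
      using i j by (simp add: Suc_diff_le algebra_simps)
    ultimately show ?thesis using i j by (simp add: u_def)
  qed
  moreover have "\<forall>i\<le>Suc k. u i \<in> B" using t(1) b(1) by (auto simp: u_def B'_def)
  ultimately show ?case by blast
qed

text \<open>The Lagrange denominator for the nodes \<open>0, ..., n\<close>. Its reciprocal is a
  binomial coefficient over \<open>fact n\<close>, so summing over \<open>i\<close> will give
  \<open>2 ^ n / fact n\<close>.\<close>

lemma prod_nat_dist_eq_fact:
  assumes "i \<le> n"
  shows "(\<Prod>j\<in>{..n} - {i}. \<bar>real i - real j\<bar>) = fact i * fact (n - i)"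
proof -
  have eq: "{..n} - {i} = {..<i} \<union> {Suc i..n}" using assms by auto
  have "(\<Prod>j<i. \<bar>real i - real j\<bar>) = (\<Prod>j<i. real (i - j))"
    by (intro prod.cong) auto
  also have "\<dots> = (\<Prod>j\<in>{1..i}. real j)"
    by (rule prod.reindex_bij_witness[of _ "\<lambda>j. i - j" "\<lambda>j. i - j"]) auto
  finally have 1: "(\<Prod>j<i. \<bar>real i - real j\<bar>) = fact i" by (simp add: fact_prod)
  have "(\<Prod>j\<in>{Suc i..n}. \<bar>real i - real j\<bar>) = (\<Prod>j\<in>{1..n-i}. real j)"
    by (rule prod.reindex_bij_witness[of _ "\<lambda>j. j + i" "\<lambda>j. j - i"]) auto
  then have 2: "(\<Prod>j\<in>{Suc i..n}. \<bar>real i - real j\<bar>) = fact (n - i)" by (simp add: fact_prod)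
  show ?thesis unfolding eq by (subst prod.union_disjoint) (auto simp only: 1 2 finite_lessThan finite_atLeastAtMost lessThan_iff atLeastAtMost_iff)
qed

text \<open>A bound for the Lebesgue constant: numerators are at most \<open>h\<close>, and
  distances of nodes are at least those of a grid of step \<open>s / Suc n\<close>. The resulting
  quotient \<open>Suc n ^ n / fact n\<close> grows only exponentially, so the total loss stays of
  the form \<open>K ^ n\<close>.\<close>

lemma lagrange_basis_sum_bound:
  fixes a h s x :: real
  assumes "0 < s" "0 < h" and t: "t ` {..n} \<subseteq> {a..a+h}" and x: "x \<in> {a..a+h}"
    and sep: "\<And>i j. i \<le> n \<Longrightarrow> j < i \<Longrightarrow> real (i - j) * (s / real (Suc n)) \<le> t i - t j"
  shows "(\<Sum>i\<le>n. \<bar>poly (lagrange_basis t n i) x\<bar>) \<le> exp 1 * (2 * exp 1 * h / s) ^ n"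
proof -
  define \<eta> where "\<eta> = s / real (Suc n)"
  have \<eta>: "\<eta> > 0" using assms by (simp add: \<eta>_def)
  have dist: "\<bar>real i - real j\<bar> * \<eta> \<le> \<bar>t i - t j\<bar>" if "i \<le> n" "j \<le> n" for i j
  proof (cases i j rule: linorder_cases)
    case less
    then show ?thesis using sep[of j i] that by (simp add: \<eta>_def of_nat_diff)
  next
    case greater
    then show ?thesis using sep[of i j] that by (simp add: \<eta>_def of_nat_diff)
  qed auto
  have each: "\<bar>poly (lagrange_basis t n i) x\<bar> \<le> (h / \<eta>) ^ n / fact n * real (n choose i)" if i: "i \<le> n" for i
  proof -
    have "\<bar>poly (lagrange_basis t n i) x\<bar> = (\<Prod>j\<in>{..n} - {i}. \<bar>x - t j\<bar> / \<bar>t i - t j\<bar>)"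
      by (simp add: poly_lagrange_basis abs_prod)
    also have "\<dots> \<le> (\<Prod>j\<in>{..n} - {i}. (h / \<eta>) / \<bar>real i - real j\<bar>)"
    proof (intro prod_mono conjI)
      fix j assume j: "j \<in> {..n} - {i}"
      then have "t j \<in> {a..a+h}" using t by blast
      then have "\<bar>x - t j\<bar> \<le> h" using x by auto
      moreover have "0 < \<bar>real i - real j\<bar> * \<eta>" using j \<eta> by auto
      moreover have "\<bar>real i - real j\<bar> * \<eta> \<le> \<bar>t i - t j\<bar>" using dist i j by auto
      ultimately have "\<bar>x - t j\<bar> / \<bar>t i - t j\<bar> \<le> h / (\<bar>real i - real j\<bar> * \<eta>)"
        by (intro frac_le) auto
      then show "\<bar>x - t j\<bar> / \<bar>t i - t j\<bar> \<le> (h / \<eta>) / \<bar>real i - real j\<bar>"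
        by (simp add: mult.commute)
    qed auto
    also have "\<dots> = (h / \<eta>) ^ n / (fact i * fact (n - i))"
      unfolding prod_dividef prod_nat_dist_eq_fact[OF i] using i by (simp add: power_divide)
    also have "\<dots> = (h / \<eta>) ^ n / fact n * real (n choose i)"
      using i by (simp add: binomial_fact)
    finally show ?thesis .
  qed
  have "(\<Sum>i\<le>n. \<bar>poly (lagrange_basis t n i) x\<bar>) \<le> (\<Sum>i\<le>n. (h / \<eta>) ^ n / fact n * real (n choose i))"
    by (intro sum_mono each) auto
  also have "\<dots> = (h / \<eta>) ^ n / fact n * 2 ^ n"
    unfolding sum_distrib_left[symmetric] by (simp flip: of_nat_sum add: choose_row_sum)
  also have "\<dots> = (2 * h / s) ^ n * (real (Suc n) ^ n / fact n)"
    by (simp add: \<eta>_def power_divide power_mult_distrib)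
  also have "\<dots> \<le> (2 * h / s) ^ n * exp (real (Suc n))"
    using assms by (intro mult_left_mono power_div_fact_le_exp) auto
  also have "exp (real (Suc n)) = exp 1 * exp 1 ^ n"
    by (metis exp_of_nat_mult mult.right_neutral power_Suc)
  also have "(2 * h / s) ^ n * (exp 1 * exp 1 ^ n) = exp 1 * (2 * exp 1 * h / s) ^ n"
    by (simp add: power_mult_distrib power_divide)
  finally show ?thesis .
qed

section \<open>Exponential sums small on a set of positive measure\<close>

text \<open>Propagation of smallness, an inequality of Remez type. Interpolation is linear with an
  error independent of the rate, so it applies to each mode and the errors add up to at most
  \<open>M * (1 / 2) ^ Suc n\<close>; the interpolant itself only sees values of \<open>g\<close> in
  \<open>E\<close>. The degree \<open>n\<close> is left free, to be balanced later.\<close>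

lemma exp_sum_small_on_interval:
  fixes A :: "nat \<Rightarrow> complex" and l :: "nat \<Rightarrow> real" and a h s M \<epsilon> x :: real
  defines "g \<equiv> \<lambda>t. \<Sum>k. A k * of_real (exp (- l k * t))"
  assumes "0 < a" "0 < h" "h \<le> a / 2" and l: "\<And>k. 0 \<le> l k"
    and A: "summable (\<lambda>k. norm (A k))" "(\<Sum>k. norm (A k)) \<le> M"
    and E: "E \<in> sets lebesgue" "E \<subseteq> {a..a+h}" "0 < s" "s \<le> measure lebesgue E"
    and small: "\<And>t. t \<in> E \<Longrightarrow> norm (g t) \<le> \<epsilon>"
    and x: "x \<in> {a..a+h}"
  shows "norm (g x) \<le> M * (1 / 2) ^ Suc n + \<epsilon> * (exp 1 * (2 * exp 1 * h / s) ^ n)"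
proof -
  have bE: "bounded E" using E(2) bounded_closed_interval bounded_subset by blast
  \<comment> \<open>Dividing by \<open>Suc n\<close> rather than \<open>n\<close> yields the strict
    inequality required by \<open>spaced_points\<close> and covers \<open>n = 0\<close>.\<close>
  have "real n * (s / real (Suc n)) < s" using E(3) by (simp add: field_simps)
  then have "real n * (s / real (Suc n)) < measure lebesgue E" using E(4) by linarith
  from spaced_points[OF bE E(1) _ this] E(3) obtain t where
    t: "\<And>i. i \<le> n \<Longrightarrow> t i \<in> E"
      "\<And>i j. i \<le> n \<Longrightarrow> j < i \<Longrightarrow> real (i - j) * (s / real (Suc n)) \<le> t i - t j"
    by auto
  have tI: "t ` {..n} \<subseteq> {a..a+h}" using t(1) E(2) by auto
  have "t j < t i" if "i \<le> n" "j < i" for i j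
  proof -
    have "0 < real (i - j) * (s / real (Suc n))" using that E(3) by simp
    then show ?thesis using t(2)[OF that] by linarith
  qed
  then have inj: "inj_on t {..n}"
    by (metis inj_onI atMost_iff less_irrefl linorder_neqE_nat)
  define L where "L i = poly (lagrange_basis t n i) x" for i
  have e1: "exp (- l k * y) \<le> 1" if "y \<in> {a..a+h}" for k y
    using that l[of k] assms(2) by simp
  have sums: "(\<lambda>k. A k * of_real (exp (- l k * y))) sums g y" if "y \<in> {a..a+h}" for y
    unfolding g_def
    using e1[OF that]
    by (intro summable_sums summable_norm_cancel[OF summable_comparison_test'[OF A(1), of 0]])
      (auto simp: norm_mult intro!: mult_left_le)
  have "(\<lambda>k. A k * of_real (exp (- l k * x)) - (\<Sum>i\<le>n. A k * of_real (exp (- l k * t i)) * of_real (L i)))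
          sums (g x - (\<Sum>i\<le>n. g (t i) * of_real (L i)))"
    using tI x by (intro sums_diff sums sums_sum sums_mult2) auto
  also have "(\<lambda>k. A k * of_real (exp (- l k * x)) - (\<Sum>i\<le>n. A k * of_real (exp (- l k * t i)) * of_real (L i)))
      = (\<lambda>k. A k * of_real (exp (- l k * x) - (\<Sum>i\<le>n. exp (- l k * t i) * L i)))"
    by (simp add: right_diff_distrib sum_distrib_left mult.assoc)
  finally have S: "(\<lambda>k. A k * of_real (exp (- l k * x) - (\<Sum>i\<le>n. exp (- l k * t i) * L i)))
          sums (g x - (\<Sum>i\<le>n. g (t i) * of_real (L i)))" .
  have bound: "norm (A k * of_real (exp (- l k * x) - (\<Sum>i\<le>n. exp (- l k * t i) * L i)))
      \<le> norm (A k) * (1 / 2) ^ Suc n" for k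
  proof -
    have "\<bar>exp (- l k * x) - (\<Sum>i\<le>n. exp (- l k * t i) * L i)\<bar> \<le> (h / a) ^ Suc n"
      unfolding L_def by (rule exp_interpolation_error[OF assms(2) l inj tI x])
    also have "\<dots> \<le> (1 / 2) ^ Suc n"
      using assms(2-4) by (intro power_mono) (auto simp: field_simps)
    finally show ?thesis unfolding norm_mult norm_of_real by (intro mult_left_mono) auto
  qed
  have "norm (g x - (\<Sum>i\<le>n. g (t i) * of_real (L i))) \<le> (\<Sum>k. norm (A k) * (1 / 2) ^ Suc n)"
    unfolding sums_unique[OF S]
    by (rule norm_suminf_le[OF bound summable_mult2[OF A(1)]])
  also have "\<dots> = (\<Sum>k. norm (A k)) * (1 / 2) ^ Suc n" by (rule suminf_mult2[OF A(1), symmetric])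
  also have "\<dots> \<le> M * (1 / 2) ^ Suc n" using A(2) by (intro mult_right_mono) auto
  finally have 1: "norm (g x - (\<Sum>i\<le>n. g (t i) * of_real (L i))) \<le> M * (1 / 2) ^ Suc n" .
  have "0 \<le> \<epsilon>" using small[OF t(1)[of 0]] norm_ge_zero[of "g (t 0)"] by linarith
  have "norm (\<Sum>i\<le>n. g (t i) * of_real (L i)) \<le> (\<Sum>i\<le>n. \<epsilon> * \<bar>L i\<bar>)"
    using small t(1) by (intro sum_norm_le) (auto simp: norm_mult intro!: mult_right_mono)
  also have "\<dots> = \<epsilon> * (\<Sum>i\<le>n. \<bar>L i\<bar>)" by (simp add: sum_distrib_left)
  also have "\<dots> \<le> \<epsilon> * (exp 1 * (2 * exp 1 * h / s) ^ n)"
    unfolding L_def using \<open>0 \<le> \<epsilon>\<close> t(2)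
    by (intro mult_left_mono lagrange_basis_sum_bound[OF E(3) assms(3) tI x]) auto
  finally have 2: "norm (\<Sum>i\<le>n. g (t i) * of_real (L i)) \<le> \<epsilon> * (exp 1 * (2 * exp 1 * h / s) ^ n)" .
  show ?thesis
    using 1 2 norm_triangle_sub[of "g x" "\<Sum>i\<le>n. g (t i) * of_real (L i)"] by linarith
qed

section \<open>Isolating one mode by shifts\<close>

lemma exp_diff_le_1:
  fixes x y :: real
  assumes "0 \<le> x" "0 \<le> y"
  shows "\<bar>exp (- x) - exp (- y)\<bar> \<le> 1"
proof -
  have "exp (- x) \<le> 1" "exp (- y) \<le> 1" using assms by auto
  then show ?thesis using exp_gt_zero[of "- x"] exp_gt_zero[of "- y"] by linarith
qed

text \<open>
  The left-hand side is the result of applying to \<open>g\<close> the commuting operators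
  \<open>g \<mapsto> exp (- l j * \<tau> j) g - g (\<cdot> + \<tau> j)\<close>, \<open>j \<in> F\<close>. They annihilate the modes in \<open>F\<close>,
  do not increase the others, and their norms are almost 1 once \<open>l j * \<tau> j\<close> is large.
\<close>

lemma exp_sum_shift_bound:
  fixes A :: "nat \<Rightarrow> complex" and l \<tau> :: "nat \<Rightarrow> real" and c h G x :: real
  defines "g \<equiv> \<lambda>t. \<Sum>k. A k * of_real (exp (- l k * t))"
  assumes "0 \<le> c" and l: "\<And>k. 0 \<le> l k" and \<tau>: "\<And>k. 0 \<le> \<tau> k"
    and A: "summable (\<lambda>k. norm (A k))"
    and small: "\<And>t. t \<in> {c..c+h} \<Longrightarrow> norm (g t) \<le> G"
    and "finite F" "c \<le> x" "x + sum \<tau> F \<le> c + h"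
  shows "norm (\<Sum>k. A k * of_real (exp (- l k * x) * (\<Prod>j\<in>F. exp (- l j * \<tau> j) - exp (- l k * \<tau> j))))
      \<le> (\<Prod>j\<in>F. 1 + exp (- l j * \<tau> j)) * G"
  using \<open>finite F\<close> \<open>c \<le> x\<close> \<open>x + sum \<tau> F \<le> c + h\<close>
proof (induction F arbitrary: x)
  case empty
  then show ?case using small[of x] by (simp add: g_def)
next
  case (insert i F)
  define \<Phi> where "\<Phi> y = (\<lambda>k. A k * of_real (exp (- l k * y) * (\<Prod>j\<in>F. exp (- l j * \<tau> j) - exp (- l k * \<tau> j))))" for y
  have summ: "summable (\<Phi> y)" if "c \<le> y" for y
  proof (rule summable_norm_cancel[OF summable_comparison_test'[OF A, of 0]])
    fix k
    have "\<bar>\<Prod>j\<in>F. exp (- l j * \<tau> j) - exp (- l k * \<tau> j)\<bar> \<le> (\<Prod>j\<in>F. 1)"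
      unfolding abs_prod using l \<tau> exp_diff_le_1[of "l _ * \<tau> _" "l k * \<tau> _"]
      by (intro prod_mono) auto
    moreover have "exp (- l k * y) \<le> 1" using that assms(2) l[of k] by simp
    ultimately have "exp (- l k * y) * \<bar>\<Prod>j\<in>F. exp (- l j * \<tau> j) - exp (- l k * \<tau> j)\<bar> \<le> 1 * 1"
      by (intro mult_mono) auto
    then show "norm (norm (\<Phi> y k)) \<le> norm (A k)"
      unfolding \<Phi>_def norm_mult norm_of_real abs_mult by (auto intro!: mult_left_le)
  qed
  have le: "x + (\<tau> i + sum \<tau> F) \<le> c + h" using insert by simp
  have bounds: "norm (suminf (\<Phi> x)) \<le> (\<Prod>j\<in>F. 1 + exp (- l j * \<tau> j)) * G"
    "norm (suminf (\<Phi> (x + \<tau> i))) \<le> (\<Prod>j\<in>F. 1 + exp (- l j * \<tau> j)) * G"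
    unfolding \<Phi>_def using insert.prems le \<tau>[of i] by (intro insert.IH; simp)+
  \<comment> \<open>The factor for \<open>i\<close> combines the old filter at \<open>x\<close> with
    the old filter at \<open>x + \<tau> i\<close>. Hence \<open>x\<close> is generalised in the
    induction, and the hypothesis restricts only \<open>x\<close> plus the sum of the remaining
    shifts.\<close>
  have split: "A k * of_real (exp (- l k * x) * (\<Prod>j\<in>insert i F. exp (- l j * \<tau> j) - exp (- l k * \<tau> j)))
      = of_real (exp (- l i * \<tau> i)) * \<Phi> x k - \<Phi> (x + \<tau> i) k" for k
  proof -
    have "exp (- l k * (x + \<tau> i)) = exp (- l k * x) * exp (- l k * \<tau> i)"
      by (simp flip: exp_add add: algebra_simps)
    then show ?thesis
      using insert by (simp add: \<Phi>_def algebra_simps)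
  qed
  have "(\<Sum>k. A k * of_real (exp (- l k * x) * (\<Prod>j\<in>insert i F. exp (- l j * \<tau> j) - exp (- l k * \<tau> j))))
      = of_real (exp (- l i * \<tau> i)) * suminf (\<Phi> x) - suminf (\<Phi> (x + \<tau> i))"
    unfolding split using insert.prems \<tau>[of i]
    by (intro sums_unique[symmetric] sums_diff sums_mult summable_sums summ) auto
  also have "norm \<dots> \<le> exp (- l i * \<tau> i) * norm (suminf (\<Phi> x)) + norm (suminf (\<Phi> (x + \<tau> i)))"
    by (rule order.trans[OF norm_triangle_ineq4]) (simp add: norm_mult)
  also have "\<dots> \<le> exp (- l i * \<tau> i) * ((\<Prod>j\<in>F. 1 + exp (- l j * \<tau> j)) * G) + (\<Prod>j\<in>F. 1 + exp (- l j * \<tau> j)) * G"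
    using bounds by (intro add_mono mult_left_mono) auto
  also have "\<dots> = (\<Prod>j\<in>insert i F. 1 + exp (- l j * \<tau> j)) * G"
    using insert by (simp add: algebra_simps)
  finally show ?case .
qed

text \<open>A finite filter removes every mode below \<open>n\<close> except \<open>k\<close>. The
  modes from \<open>n\<close> on survive but are not enlarged, so for large \<open>n\<close> they
  contribute less than any given \<open>e\<close>. This limit is why \<open>P\<close> and
  \<open>Q\<close> bound all finite products uniformly.\<close>

lemma exp_sum_coeff_bound:
  fixes A :: "nat \<Rightarrow> complex" and l \<tau> :: "nat \<Rightarrow> real" and c h G P Q :: real
  defines "g \<equiv> \<lambda>t. \<Sum>k. A k * of_real (exp (- l k * t))"
  assumes "0 \<le> c" and l: "\<And>k. 0 \<le> l k" and \<tau>: "\<And>k. 0 \<le> \<tau> k"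
    and A: "summable (\<lambda>k. norm (A k))"
    and small: "\<And>t. t \<in> {c..c+h} \<Longrightarrow> norm (g t) \<le> G"
    and \<tau>_sum: "\<And>F. finite F \<Longrightarrow> sum \<tau> F \<le> h"
    and Q: "\<And>F. finite F \<Longrightarrow> (\<Prod>j\<in>F. 1 + exp (- l j * \<tau> j)) \<le> Q"
    and P: "\<And>n. P \<le> (\<Prod>j\<in>{..<n} - {k}. \<bar>exp (- l j * \<tau> j) - exp (- l k * \<tau> j)\<bar>)"
  shows "norm (A k) * exp (- l k * c) * P \<le> Q * G"
proof (rule field_le_epsilon)
  fix e :: real assume "e > 0"
  then obtain N where N: "\<And>n. n \<ge> N \<Longrightarrow> norm (\<Sum>i. norm (A (i + n))) < e"
    using suminf_exist_split[OF _ A] by blast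
  \<comment> \<open>With \<open>k < n\<close> the mode to be kept belongs to the initial segment and
    not to the discarded tail.\<close>
  define n where "n = max N (Suc k)"
  define F where "F = {..<n} - {k}"
  have F: "finite F" by (simp add: F_def)
  have h: "0 \<le> h" using \<tau>_sum[of "{}"] by simp
  have "norm (g c) \<le> G" using small[of c] h by simp
  then have G: "0 \<le> G" using norm_ge_zero[of "g c"] by linarith
  define \<Phi> where "\<Phi> i = A i * of_real (exp (- l i * c) * (\<Prod>j\<in>F. exp (- l j * \<tau> j) - exp (- l i * \<tau> j)))" for i
  have \<Phi>_le: "norm (\<Phi> i) \<le> norm (A i)" for i
  proof -
    have "\<bar>\<Prod>j\<in>F. exp (- l j * \<tau> j) - exp (- l i * \<tau> j)\<bar> \<le> (\<Prod>j\<in>F. 1)"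
      unfolding abs_prod using l \<tau> exp_diff_le_1[of "l _ * \<tau> _" "l i * \<tau> _"]
      by (intro prod_mono) auto
    moreover have "exp (- l i * c) \<le> 1" using assms(2) l[of i] by simp
    ultimately have "exp (- l i * c) * \<bar>\<Prod>j\<in>F. exp (- l j * \<tau> j) - exp (- l i * \<tau> j)\<bar> \<le> 1 * 1"
      by (intro mult_mono) auto
    then show ?thesis
      unfolding \<Phi>_def norm_mult norm_of_real abs_mult by (auto intro!: mult_left_le)
  qed
  have summ: "summable \<Phi>"
    by (rule summable_norm_cancel[OF summable_comparison_test'[OF A, of 0]]) (simp add: \<Phi>_le)
  have total: "norm (suminf \<Phi>) \<le> Q * G"
  proof -
    have "norm (suminf \<Phi>) \<le> (\<Prod>j\<in>F. 1 + exp (- l j * \<tau> j)) * G"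
      unfolding \<Phi>_def using small \<tau>_sum[OF F]
      by (intro exp_sum_shift_bound[OF assms(2) l \<tau> A]) (auto simp: g_def F)
    also have "\<dots> \<le> Q * G" using Q[OF F] G by (rule mult_right_mono)
    finally show ?thesis .
  qed
  have zero: "\<Phi> i = 0" if "i \<in> F" for i
  proof -
    have "(\<Prod>j\<in>F. exp (- l j * \<tau> j) - exp (- l i * \<tau> j)) = 0"
      using that F by (intro prod_zero) auto
    then show ?thesis by (simp add: \<Phi>_def)
  qed
  have "{..<n} = insert k F" "k \<notin> F" by (auto simp: F_def n_def)
  then have "sum \<Phi> {..<n} = \<Phi> k" using F zero by simp
  then have "suminf \<Phi> = (\<Sum>i. \<Phi> (i + n)) + \<Phi> k"
    using suminf_split_initial_segment[OF summ, of n] by simp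
  then have "norm (\<Phi> k) \<le> norm (suminf \<Phi>) + norm (\<Sum>i. \<Phi> (i + n))"
    by (metis add_diff_cancel_left' norm_triangle_ineq4)
  moreover have "norm (\<Sum>i. \<Phi> (i + n)) \<le> (\<Sum>i. norm (A (i + n)))"
    by (rule norm_suminf_le[OF _ summable_ignore_initial_segment[OF A]]) (rule \<Phi>_le)
  moreover have "(\<Sum>i. norm (A (i + n))) < e"
    using N[of n] by (auto simp: n_def)
  ultimately have "norm (\<Phi> k) \<le> Q * G + e" using total by linarith
  moreover have "norm (\<Phi> k) = norm (A k) * exp (- l k * c) * (\<Prod>j\<in>F. \<bar>exp (- l j * \<tau> j) - exp (- l k * \<tau> j)\<bar>)"
    unfolding \<Phi>_def norm_mult norm_of_real abs_mult abs_prod by simp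
  moreover have "norm (A k) * exp (- l k * c) * P \<le> norm (A k) * exp (- l k * c) * (\<Prod>j\<in>F. \<bar>exp (- l j * \<tau> j) - exp (- l k * \<tau> j)\<bar>)"
    using P[of n] by (intro mult_left_mono) (auto simp: F_def)
  ultimately show "norm (A k) * exp (- l k * c) * P \<le> Q * G + e" by linarith
qed

section \<open>The multiplier of an isolated mode\<close>

lemma summable_exp_neg_powr:
  fixes c \<gamma> :: real
  assumes "0 < c" "0 < \<gamma>"
  shows "summable (\<lambda>n. exp (- c * real (Suc n) powr \<gamma>))"
proof (rule summable_comparison_test_bigo)
  show "summable (\<lambda>n. norm (real n powr - 2))" by (simp add: summable_real_powr_iff)
  show "(\<lambda>n. exp (- c * real (Suc n) powr \<gamma>)) \<in> O(\<lambda>n. real n powr - 2)"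
    using assms by real_asymp
qed

text \<open>Each factor obeys \<open>1 / (1 - w) = 1 + w / (1 - w) \<le> 1 + w / d \<le> exp (w /
  d)\<close>. With a summable \<open>w\<close> this bounds all finite products from below by one
  positive constant.\<close>

lemma exp_neg_le_prod_one_minus:
  fixes w :: "'a \<Rightarrow> real"
  assumes "finite F" "0 < d" "\<And>j. j \<in> F \<Longrightarrow> 0 \<le> w j" "\<And>j. j \<in> F \<Longrightarrow> w j \<le> 1 - d" "sum w F \<le> W"
  shows "exp (- (W / d)) \<le> (\<Prod>j\<in>F. 1 - w j)"
proof -
  have "exp (- (W / d)) \<le> exp (- (sum w F / d))"
    using assms by (simp add: divide_right_mono)
  also have "\<dots> = (\<Prod>j\<in>F. exp (- (w j / d)))"
    using assms(1) by (simp add: exp_sum sum_divide_distrib flip: sum_negf)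
  also have "\<dots> \<le> (\<Prod>j\<in>F. 1 - w j)"
  proof (intro prod_mono conjI)
    fix j assume j: "j \<in> F"
    have pos: "0 < 1 - w j" using assms(2) assms(4)[OF j] by linarith
    have "1 / (1 - w j) = 1 + w j / (1 - w j)" using pos by (simp add: field_simps)
    also have "\<dots> \<le> 1 + w j / d"
      using assms(2) assms(3,4)[OF j] pos by (intro add_left_mono divide_left_mono) auto
    also have "\<dots> \<le> exp (w j / d)" by (rule exp_ge_add_one_self)
    finally have "1 \<le> exp (w j / d) * (1 - w j)" using pos by (simp add: divide_le_eq)
    then have "exp (- (w j / d)) * 1 \<le> exp (- (w j / d)) * (exp (w j / d) * (1 - w j))"
      by (intro mult_left_mono) auto
    also have "\<dots> = 1 - w j" by (simp add: exp_minus)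
    finally show "exp (- (w j / d)) \<le> 1 - w j" by simp
  qed auto
  finally show ?thesis .
qed

lemma prod_one_plus_le_exp_sum:
  fixes v :: "'a \<Rightarrow> real"
  assumes "\<And>j. j \<in> F \<Longrightarrow> 0 \<le> v j"
  shows "(\<Prod>j\<in>F. 1 + v j) \<le> exp (sum v F)"
proof (cases "finite F")
  case True
  have "(\<Prod>j\<in>F. 1 + v j) \<le> (\<Prod>j\<in>F. exp (v j))"
    using assms by (intro prod_mono) (auto simp: add_nonneg_nonneg)
  then show ?thesis using True by (simp add: exp_sum)
qed auto

text \<open>Both signs of \<open>y\<close> matter, since \<open>y\<close> will be
  \<open>(l j - l k) * \<tau> j\<close> with \<open>j\<close> on either side of \<open>k\<close>.
  The cap \<open>z \<le> 1\<close> reflects that the right-hand side saturates for large positive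
  \<open>y\<close>.\<close>

lemma half_le_abs_one_minus_exp:
  fixes y z :: real
  assumes "0 \<le> z" "z \<le> 1" "z \<le> \<bar>y\<bar>"
  shows "z / 2 \<le> \<bar>1 - exp (- y)\<bar>"
proof (cases "0 \<le> y")
  case True
  have "(1 - z / 2) * (1 + z) = 1 + z * (1 - z) / 2" by (simp add: field_simps power2_eq_square)
  moreover have "0 \<le> z * (1 - z) / 2" using assms by auto
  ultimately have "1 \<le> (1 - z / 2) * (1 + z)" by linarith
  also have "\<dots> \<le> (1 - z / 2) * exp z" using assms by (intro mult_left_mono) auto
  finally have "exp (- z) \<le> 1 - z / 2" by (simp add: exp_minus field_simps)
  moreover have "exp (- y) \<le> exp (- z)" using True assms by simp
  ultimately show ?thesis by linarith
next
  case False
  then show ?thesis using assms exp_ge_add_one_self[of "- y"] by linarith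
qed

lemma powr_diff_lower:
  fixes x y \<beta> :: real
  assumes "1 \<le> \<beta>" "0 < x" "x \<le> y"
  shows "y powr (\<beta> - 1) * (y - x) \<le> y powr \<beta> - x powr \<beta>"
proof -
  have eq: "z powr \<beta> = z powr (\<beta> - 1) * z" if "0 < z" for z :: real
    using that powr_add[of z "\<beta> - 1" 1] by simp
  have "x powr (\<beta> - 1) * x \<le> y powr (\<beta> - 1) * x"
    using assms by (intro mult_right_mono powr_mono2) auto
  then show ?thesis using assms eq[of x] eq[of y] by (simp add: algebra_simps)
qed

lemma powr_gap_ge_1:
  fixes j k :: nat
  assumes "1 \<le> \<beta>" "j \<noteq> k"
  shows "1 \<le> \<bar>real (Suc j) powr \<beta> - real (Suc k) powr \<beta>\<bar>"
proof -
  have *: "1 \<le> real (Suc j) powr \<beta> - real (Suc i) powr \<beta>" if "i < j" for i j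
  proof -
    have "1 * 1 \<le> real (Suc j) powr (\<beta> - 1) * (real (Suc j) - real (Suc i))"
      using that assms by (intro mult_mono ge_one_powr_ge_zero) auto
    also have "\<dots> \<le> real (Suc j) powr \<beta> - real (Suc i) powr \<beta>"
      using that assms by (intro powr_diff_lower) auto
    finally show ?thesis by simp
  qed
  show ?thesis
    using *[of j k] *[of k j] assms(2) by (cases j k rule: linorder_cases) auto
qed

text \<open>For \<open>j < 2 * Suc k\<close> only the gap
  \<open>\<bar>l j - l k\<bar> \<ge> 1\<close> is available, and
  \<open>\<tau> j \<ge> \<kappa> * (2 * Suc k) powr (- 2)\<close>;
  \<open>half_le_abs_one_minus_exp\<close> halves the resulting
  \<open>\<kappa> / (4 * (Suc k)\<^sup>2)\<close>. For larger \<open>j\<close> the difference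
  \<open>l j - l k\<close> is at least half of \<open>l j\<close>, so the exponential is below a
  summable bound independent of \<open>k\<close>. The second factor is kept in the near case as
  well, so that it multiplies up to a single product free of \<open>k\<close>.\<close>

lemma shift_factor_lower:
  fixes \<beta> p \<kappa> :: real and j k :: nat
  defines "l \<equiv> \<lambda>k. real (Suc k) powr \<beta>" and "\<tau> \<equiv> \<lambda>k. \<kappa> * real (Suc k) powr (- p)"
  assumes "1 \<le> \<beta>" "p \<le> 2" "0 < \<kappa>" "\<kappa> \<le> 1" "j \<noteq> k"
  shows "(if j < 2 * Suc k then \<kappa> / (8 * (real (Suc k))\<^sup>2) else 1)
        * (1 - exp (- (\<kappa> / 2) * real (Suc j) powr (\<beta> - p)))
      \<le> \<bar>1 - exp (- (l j - l k) * \<tau> j)\<bar>"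
proof -
  define w where "w = exp (- (\<kappa> / 2) * real (Suc j) powr (\<beta> - p))"
  have w: "0 \<le> w" "w \<le> 1" using assms by (auto simp: w_def)
  show ?thesis
  proof (cases "j < 2 * Suc k")
    case True
    define r where "r = \<kappa> / (8 * (real (Suc k))\<^sup>2)"
    have K1: "1 \<le> (real (Suc k))\<^sup>2" by simp
    have "r \<le> 1 / 8"
      unfolding r_def using assms K1 by (intro frac_le) auto
    moreover have r0: "0 \<le> r" using assms by (simp add: r_def)
    moreover have "2 * r \<le> \<bar>(l j - l k) * \<tau> j\<bar>"
    proof -
      have "2 * r = \<kappa> * (2 * real (Suc k)) powr (- 2)"
      proof -
        have "(2 * real (Suc k)) powr (- 2) = inverse ((2 * real (Suc k)) ^ 2)"
          by (simp add: powr_minus powr_numeral)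
        then show ?thesis unfolding r_def power_mult_distrib by (simp add: inverse_eq_divide)
      qed
      also have "\<dots> \<le> \<kappa> * real (Suc j) powr (- 2)"
        using True assms by (intro mult_left_mono powr_mono2') auto
      also have "\<dots> \<le> \<tau> j"
        unfolding \<tau>_def using assms by (intro mult_left_mono powr_mono) auto
      finally have "1 * (2 * r) \<le> \<bar>l j - l k\<bar> * \<bar>\<tau> j\<bar>"
        using r0 powr_gap_ge_1[OF assms(3) \<open>j \<noteq> k\<close>] unfolding l_def
        by (intro mult_mono) auto
      then show ?thesis by (simp add: abs_mult)
    qed
    ultimately have "r \<le> \<bar>1 - exp (- (l j - l k) * \<tau> j)\<bar>"
      using half_le_abs_one_minus_exp[of "2 * r" "(l j - l k) * \<tau> j"]
      unfolding mult_minus_left by simp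
    moreover have "r * (1 - w) \<le> r" using r0 w by (simp add: mult_left_le)
    ultimately show ?thesis using True unfolding w_def r_def by simp
  next
    case False
    then have jk: "2 * real (Suc k) \<le> real (Suc j)" by simp
    have "real (Suc j) powr \<beta> / 2 = real (Suc j) powr (\<beta> - 1) * (real (Suc j) / 2)"
      using powr_add[of "real (Suc j)" "\<beta> - 1" 1] by simp
    also have "\<dots> \<le> real (Suc j) powr (\<beta> - 1) * (real (Suc j) - real (Suc k))"
      using jk by (intro mult_left_mono) auto
    also have "\<dots> \<le> l j - l k"
      unfolding l_def using assms jk by (intro powr_diff_lower) auto
    finally have "real (Suc j) powr \<beta> / 2 * \<tau> j \<le> (l j - l k) * \<tau> j"
      using assms by (intro mult_right_mono) (auto simp: \<tau>_def)
    moreover have "real (Suc j) powr \<beta> / 2 * \<tau> j = (\<kappa> / 2) * real (Suc j) powr (\<beta> - p)"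
      by (simp add: \<tau>_def powr_diff powr_minus field_simps)
    ultimately have "exp (- (l j - l k) * \<tau> j) \<le> w" unfolding w_def mult_minus_left by simp
    then have "1 - w \<le> \<bar>1 - exp (- (l j - l k) * \<tau> j)\<bar>" by linarith
    then show ?thesis using False unfolding w_def[symmetric] by simp
  qed
qed

text \<open>The cost of at most \<open>2 * K\<close> near factors. The logarithm of the left factor
  count is of order \<open>K * ln K\<close>; \<open>ln K \<le> K\<close> coarsens it to
  \<open>K\<^sup>2\<close>, the order in which the other losses are measured too.\<close>

lemma power_inverse_square_lower:
  fixes \<kappa> K :: real and m :: nat
  assumes "0 < \<kappa>" "1 \<le> K" "real m \<le> 2 * K" "\<kappa> \<le> 1"
  shows "exp (- (2 * ln (8 / \<kappa>) + 4) * K\<^sup>2) \<le> (\<kappa> / (8 * K\<^sup>2)) ^ m"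
proof -
  have "K \<le> K\<^sup>2" using assms by (simp add: power2_eq_square)
  have ln8: "0 \<le> ln (8 / \<kappa>)" using assms by simp
  have "real m * (ln (8 / \<kappa>) + 2 * ln K) \<le> (2 * K) * (ln (8 / \<kappa>) + 2 * K)"
    using assms ln8 ln_bound[of K] by (intro mult_mono) auto
  also have "\<dots> = 2 * ln (8 / \<kappa>) * K + 4 * K\<^sup>2" by (simp add: algebra_simps power2_eq_square)
  also have "\<dots> \<le> 2 * ln (8 / \<kappa>) * K\<^sup>2 + 4 * K\<^sup>2"
    using ln8 \<open>K \<le> K\<^sup>2\<close> by (intro add_right_mono mult_left_mono) auto
  finally have "- (2 * ln (8 / \<kappa>) + 4) * K\<^sup>2 \<le> real m * ln (\<kappa> / (8 * K\<^sup>2))"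
    using assms by (simp add: ln_div ln_mult ln_realpow algebra_simps)
  then have "exp (- (2 * ln (8 / \<kappa>) + 4) * K\<^sup>2) \<le> exp (real m * ln (\<kappa> / (8 * K\<^sup>2)))"
    by simp
  also have "\<dots> = (\<kappa> / (8 * K\<^sup>2)) ^ m"
    using assms by (simp add: exp_of_nat_mult)
  finally show ?thesis .
qed

text \<open>Pulling \<open>exp (- l k * \<tau> j)\<close> out of each factor leaves the quantity of
  \<open>shift_factor_lower\<close>. The extracted exponentials cost at most
  \<open>exp (- h * (Suc k)\<^sup>2)\<close> because the shifts add up to at most \<open>h\<close>,
  the near factors cost \<open>exp (- E * (Suc k)\<^sup>2)\<close>, and the rest is a convergent
  product bounded below by \<open>c\<close>. Nothing depends on \<open>n\<close>.\<close>

lemma shift_product_lower: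
  fixes \<beta> p \<kappa> h :: real
  defines "l \<equiv> \<lambda>k. real (Suc k) powr \<beta>" and "\<tau> \<equiv> \<lambda>k. \<kappa> * real (Suc k) powr (- p)"
  assumes "1 \<le> \<beta>" "\<beta> \<le> 2" "p < \<beta>" "0 < \<kappa>" "\<kappa> \<le> 1"
    and \<tau>_sum: "\<And>F. finite F \<Longrightarrow> sum \<tau> F \<le> h"
  shows "\<exists>c>0. \<exists>D. \<forall>k n. c * exp (- D * (real (Suc k))\<^sup>2)
      \<le> (\<Prod>j\<in>{..<n} - {k}. \<bar>exp (- l j * \<tau> j) - exp (- l k * \<tau> j)\<bar>)"
proof -
  define w where "w j = exp (- (\<kappa> / 2) * real (Suc j) powr (\<beta> - p))" for j
  \<comment> \<open>\<open>1 - d\<close> is \<open>w 0\<close>, the largest value of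
    \<open>w\<close>, because \<open>p < \<beta>\<close>.\<close>
  define d where "d = 1 - exp (- (\<kappa> / 2))"
  define c where "c = exp (- (suminf w / d))"
  define E where "E = 2 * ln (8 / \<kappa>) + 4"
  have "0 < d" using assms by (simp add: d_def)
  have sw: "summable w" unfolding w_def using assms by (intro summable_exp_neg_powr) auto
  have w0: "0 \<le> w j" for j by (simp add: w_def)
  have wd: "w j \<le> 1 - d" for j
  proof -
    have "1 \<le> real (Suc j) powr (\<beta> - p)" using assms by (intro ge_one_powr_ge_zero) auto
    then show ?thesis using assms by (simp add: w_def d_def)
  qed
  have h: "0 \<le> h" using \<tau>_sum[of "{}"] by simp
  have "c * exp (- (h + E) * (real (Suc k))\<^sup>2)
      \<le> (\<Prod>j\<in>{..<n} - {k}. \<bar>exp (- l j * \<tau> j) - exp (- l k * \<tau> j)\<bar>)" for k n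
  proof -
    define F where "F = {..<n} - {k}"
    define r where "r = \<kappa> / (8 * (real (Suc k))\<^sup>2)"
    have F: "finite F" by (simp add: F_def)
    have K1: "1 \<le> (real (Suc k))\<^sup>2" by simp
    have r: "0 < r" "r \<le> 1"
    proof -
      show "0 < r" using assms by (simp add: r_def)
      have "8 * (real (Suc k))\<^sup>2 \<ge> \<kappa>" using K1 assms by linarith
      then show "r \<le> 1" unfolding r_def by (simp add: divide_le_eq)
    qed
    have lk: "l k \<le> (real (Suc k))\<^sup>2"
      unfolding l_def using assms powr_mono[of \<beta> 2 "real (Suc k)"] by (simp add: powr_numeral)
    have "exp (- h * (real (Suc k))\<^sup>2) \<le> exp (- l k * sum \<tau> F)"
      using mult_mono[OF lk \<tau>_sum[OF F]] h assms
      by (auto simp: \<tau>_def sum_nonneg mult.commute)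
    also have "\<dots> = (\<Prod>j\<in>F. exp (- l k * \<tau> j))"
      using F by (simp add: exp_sum sum_distrib_left flip: sum_negf)
    finally have 1: "exp (- h * (real (Suc k))\<^sup>2) \<le> (\<Prod>j\<in>F. exp (- l k * \<tau> j))" .
    have "exp (- E * (real (Suc k))\<^sup>2) \<le> r ^ (2 * Suc k)"
      unfolding r_def E_def using assms by (intro power_inverse_square_lower) auto
    also have "\<dots> \<le> r ^ card {j \<in> F. j < 2 * Suc k}"
      using r card_mono[of "{..<2 * Suc k}" "{j \<in> F. j < 2 * Suc k}"]
      by (intro power_decreasing) auto
    also have "\<dots> = (\<Prod>j\<in>F. if j < 2 * Suc k then r else 1)"
      using F by (simp add: prod.If_cases Collect_conj_eq Int_commute)
    finally have 2: "exp (- E * (real (Suc k))\<^sup>2) \<le> (\<Prod>j\<in>F. if j < 2 * Suc k then r else 1)" .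
    have 3: "c \<le> (\<Prod>j\<in>F. 1 - w j)"
      unfolding c_def using \<open>0 < d\<close> wd sw F
      by (intro exp_neg_le_prod_one_minus sum_le_suminf) (auto intro: w0)
    have "c * exp (- (h + E) * (real (Suc k))\<^sup>2)
        = exp (- h * (real (Suc k))\<^sup>2) * (exp (- E * (real (Suc k))\<^sup>2) * c)"
      by (simp add: algebra_simps flip: exp_add)
    also have "\<dots> \<le> (\<Prod>j\<in>F. exp (- l k * \<tau> j)) * ((\<Prod>j\<in>F. if j < 2 * Suc k then r else 1) * (\<Prod>j\<in>F. 1 - w j))"
      using 1 2 3 r by (intro mult_mono) (auto intro!: mult_nonneg_nonneg prod_nonneg simp: c_def)
    also have "\<dots> = (\<Prod>j\<in>F. exp (- l k * \<tau> j) * ((if j < 2 * Suc k then r else 1) * (1 - w j)))"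
      by (simp add: prod.distrib)
    also have "\<dots> \<le> (\<Prod>j\<in>F. \<bar>exp (- l j * \<tau> j) - exp (- l k * \<tau> j)\<bar>)"
    proof (intro prod_mono conjI)
      fix j assume j: "j \<in> F"
      have w1: "0 \<le> 1 - w j" using wd[of j] \<open>0 < d\<close> by linarith
      then show "0 \<le> exp (- l k * \<tau> j) * ((if j < 2 * Suc k then r else 1) * (1 - w j))"
        using r by (intro mult_nonneg_nonneg) auto
      have "exp (- l k * \<tau> j) * ((if j < 2 * Suc k then r else 1) * (1 - w j))
          \<le> exp (- l k * \<tau> j) * \<bar>1 - exp (- (l j - l k) * \<tau> j)\<bar>"
        unfolding l_def \<tau>_def w_def r_def using j assms
        by (intro mult_left_mono shift_factor_lower) (auto simp: F_def)
      also have "\<dots> = \<bar>exp (- l k * \<tau> j) * (1 - exp (- (l j - l k) * \<tau> j))\<bar>"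
        by (simp add: abs_mult)
      also have "exp (- l k * \<tau> j) * (1 - exp (- (l j - l k) * \<tau> j)) = exp (- l k * \<tau> j) - exp (- l j * \<tau> j)"
        by (simp add: algebra_simps flip: exp_add)
      finally show "exp (- l k * \<tau> j) * ((if j < 2 * Suc k then r else 1) * (1 - w j))
          \<le> \<bar>exp (- l j * \<tau> j) - exp (- l k * \<tau> j)\<bar>"
        by (simp only: abs_minus_commute)
    qed
    finally show ?thesis unfolding F_def .
  qed
  moreover have "c > 0" by (simp add: c_def)
  ultimately show ?thesis by blast
qed

section \<open>Parseval's identity for sine series\<close>

lemma borel_measurable_lebesgue_if_continuous:
  fixes \<phi> :: "real \<Rightarrow> real"
  assumes "continuous_on UNIV \<phi>"
  shows "\<phi> \<in> borel_measurable lebesgue"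
  using assms by (intro measurable_completion) (auto intro: borel_measurable_continuous_onI)

text \<open>The orthogonality is carried over to indicators: of closed sets by dominated
  convergence, of Borel sets because closed sets form a generator stable under intersection, of
  Lebesgue sets because they are F-sigma up to a null set. A function whose integral over every
  measurable set vanishes is zero almost everywhere.\<close>

lemma AE_zero_if_orthogonal_continuous:
  fixes F :: "real \<Rightarrow> complex"
  assumes S: "S \<in> lmeasurable" and F: "integrable (lebesgue_on S) F"
    and orth: "\<And>\<psi>. continuous_on UNIV \<psi> \<Longrightarrow> (LINT x|lebesgue_on S. \<psi> x *\<^sub>R F x) = 0"
  shows "AE x in lebesgue_on S. F x = 0"
proof -
  define H where "H x = indicator S x *\<^sub>R F x" for x
  have Ssets: "S \<inter> space lebesgue \<in> sets lebesgue" using S by (simp add: fmeasurableD)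
  have H: "integrable lebesgue H"
    using F unfolding H_def by (subst (asm) integrable_restrict_space[OF Ssets])
  have orthH: "(LINT x|lebesgue. \<psi> x *\<^sub>R H x) = 0" if "continuous_on UNIV \<psi>" for \<psi> :: "real \<Rightarrow> real"
    using orth[OF that] unfolding H_def
    by (subst (asm) integral_restrict_space[OF Ssets]) (simp add: mult.commute)
  have int: "integrable lebesgue (\<lambda>x. indicator B x *\<^sub>R H x)" if "B \<in> sets lebesgue" for B :: "real set"
    using H that by (rule integrable_mult_indicator[rotated])
  have closed: "(LINT x|lebesgue. indicator C x *\<^sub>R H x) = 0" if C: "closed C" for C :: "real set"
  proof (cases "C = {}")
    case False
    \<comment> \<open>Continuous tents between 0 and 1 that converge pointwise to the indicator of
      \<open>C\<close>; closedness gives \<open>infdist x C > 0\<close> off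
      \<open>C\<close>.\<close>
    define \<psi> where "\<psi> n x = max 0 (1 - real n * infdist x C)" for n x
    have cont: "continuous_on UNIV (\<psi> n)" for n
      unfolding \<psi>_def by (intro continuous_intros)
    have lim: "(\<lambda>n. \<psi> n x) \<longlonglongrightarrow> indicator C x" for x
    proof (cases "x \<in> C")
      case True
      then show ?thesis by (simp add: \<psi>_def)
    next
      case notin: False
      then have pos: "0 < infdist x C"
        using in_closed_iff_infdist_zero[OF C False] infdist_nonneg[of x C] by force
      obtain N where N: "1 < real N * infdist x C" using pos reals_Archimedean3 by blast
      have "\<psi> n x = 0" if "n \<ge> N" for n
      proof -
        have "real N * infdist x C \<le> real n * infdist x C"
          using that pos by (intro mult_right_mono) auto
        then show ?thesis using N by (simp add: \<psi>_def)
      qed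
      then show ?thesis using notin by (auto intro!: tendsto_eventually eventually_sequentiallyI)
    qed
    have "(\<lambda>n. LINT x|lebesgue. \<psi> n x *\<^sub>R H x) \<longlonglongrightarrow> (LINT x|lebesgue. indicator C x *\<^sub>R H x)"
    proof (rule integral_dominated_convergence[where w = "\<lambda>x. norm (H x)"])
      show "(\<lambda>x. indicator C x *\<^sub>R H x) \<in> borel_measurable lebesgue"
        using int[of C] C by auto
      show "(\<lambda>x. \<psi> n x *\<^sub>R H x) \<in> borel_measurable lebesgue" for n
        using H cont[of n] by (intro borel_measurable_scaleR borel_measurable_lebesgue_if_continuous) auto
      show "integrable lebesgue (\<lambda>x. norm (H x))" using H by simp
      show "AE x in lebesgue. (\<lambda>n. \<psi> n x *\<^sub>R H x) \<longlonglongrightarrow> indicator C x *\<^sub>R H x"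
        by (intro AE_I2 tendsto_scaleR lim tendsto_const)
      show "AE x in lebesgue. norm (\<psi> n x *\<^sub>R H x) \<le> norm (H x)" for n
        by (intro AE_I2) (auto simp: \<psi>_def infdist_nonneg intro!: mult_left_le_one_le)
    qed
    then show ?thesis using orthH[OF cont] by (simp add: LIMSEQ_const_iff)
  qed auto
  have borel: "(LINT x|lebesgue. indicator B x *\<^sub>R H x) = 0" if "B \<in> sets borel" for B :: "real set"
  proof -
    have "Int_stable (Collect closed)" "Collect closed \<subseteq> Pow (UNIV :: real set)" "B \<in> sigma_sets UNIV (Collect closed)"
      using that by (auto simp: Int_stable_def borel_eq_closed)
    then show ?thesis
    proof (induction rule: sigma_sets_induct_disjoint)
      case (basic A)
      then show ?case using closed by simp
    next
      case (compl A)
      then have "A \<in> sets borel" by (simp add: borel_eq_closed)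
      then have A: "A \<in> sets lebesgue" by simp
      have "(LINT x|lebesgue. H x - indicator A x *\<^sub>R H x) = (LINT x|lebesgue. H x) - 0"
        using compl H int[OF A] by simp
      also have "\<dots> = 0" using orthH[of "\<lambda>_. 1"] by simp
      also have "(\<lambda>x. H x - indicator A x *\<^sub>R H x) = (\<lambda>x. indicator (UNIV - A) x *\<^sub>R H x)"
        by (auto simp: indicator_def)
      finally show ?case .
    next
      case (union A)
      then have "A i \<in> sets borel" for i
        by (auto simp: borel_eq_closed)
      then have A: "A i \<in> sets lebesgue" for i by simp
      have "(LINT x:(\<Union>i. A i)|lebesgue. H x) = (\<Sum>i. LINT x:A i|lebesgue. H x)"
        using A union(1) int[of "\<Union>i. A i"]
        by (intro lebesgue_integral_countable_add) (auto simp: disjoint_family_on_def set_integrable_def)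
      then show ?case using union by (simp add: set_lebesgue_integral_def)
    qed auto
  qed
  have leb: "(LINT x|lebesgue. indicator A x *\<^sub>R H x) = 0" if A: "A \<in> sets lebesgue" for A :: "real set"
  proof -
    obtain C T where CT: "fsigma C" "T \<in> null_sets lebesgue" "C \<union> T = A" "disjnt C T"
      using lebesgue_set_almost_fsigma[OF A] by metis
    have C: "C \<in> sets borel"
      using CT(1) by (auto simp: fsigma.simps)
    have "AE x in lebesgue. x \<notin> T" using CT(2) by (rule AE_not_in)
    then have "AE x in lebesgue. indicator A x *\<^sub>R H x = indicator C x *\<^sub>R H x"
      by eventually_elim (use CT(3) in \<open>auto simp: indicator_def\<close>)
    then have "(LINT x|lebesgue. indicator A x *\<^sub>R H x) = (LINT x|lebesgue. indicator C x *\<^sub>R H x)"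
      using C by (intro integral_cong_AE borel_measurable_integrable int A) auto
    then show ?thesis using borel[OF C] by simp
  qed
  interpret finite_measure "lebesgue_on S" by (rule finite_measure_lebesgue_on[OF S])
  show ?thesis
  proof (rule density_zero[OF F])
    fix A assume "A \<in> sets (lebesgue_on S)"
    then have A: "A \<in> sets lebesgue" using S by (simp add: sets_restrict_space_iff fmeasurableD)
    have "set_lebesgue_integral (lebesgue_on S) A F = (LINT x|lebesgue. indicator A x *\<^sub>R H x)"
      unfolding set_lebesgue_integral_def H_def
      by (subst integral_restrict_space[OF Ssets]) (simp add: mult.commute)
    then show "set_lebesgue_integral (lebesgue_on S) A F = 0" using leb[OF A] by simp
  qed
qed

lemma integrable_mult_bounded_continuous:
  fixes f :: "real \<Rightarrow> complex" and \<phi> :: "real \<Rightarrow> real"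
  assumes "integrable (lebesgue_on S) f" "continuous_on UNIV \<phi>" "\<And>x. x \<in> S \<Longrightarrow> \<bar>\<phi> x\<bar> \<le> C"
  shows "integrable (lebesgue_on S) (\<lambda>x. f x * of_real (\<phi> x))"
proof (rule Bochner_Integration.integrable_bound)
  show "integrable (lebesgue_on S) (\<lambda>x. C *\<^sub>R f x)" using assms(1) by simp
  have "\<phi> \<in> borel_measurable (lebesgue_on S)"
    using assms(2) by (intro measurable_restrict_space1 borel_measurable_lebesgue_if_continuous)
  then show "(\<lambda>x. f x * of_real (\<phi> x)) \<in> borel_measurable (lebesgue_on S)"
    using assms(1) by measurable
  show "AE x in lebesgue_on S. norm (f x * of_real (\<phi> x)) \<le> norm (C *\<^sub>R f x)"
  proof (rule AE_I2)
    fix x assume "x \<in> space (lebesgue_on S)"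
    then have "\<bar>\<phi> x\<bar> \<le> \<bar>C\<bar>" using assms(3)[of x] by simp
    then show "norm (f x * of_real (\<phi> x)) \<le> norm (C *\<^sub>R f x)"
      by (simp add: norm_mult mult.commute mult_right_mono)
  qed
qed

text \<open>Completeness of the sine system. Every \<open>p (cos x) * sin x\<close> with a
  polynomial \<open>p\<close> is a combination of sines, and by Weierstrass the
  \<open>p (cos x)\<close> are uniformly dense in the continuous functions on
  \<open>{0..pi}\<close>. So \<open>f x * sin x\<close> is orthogonal to all continuous functions,
  and \<open>sin\<close> has no zero inside the interval.\<close>

lemma AE_zero_if_sine_coeff_zero:
  fixes f :: "real \<Rightarrow> complex"
  assumes f: "integrable (lebesgue_on {0<..<pi}) f"
    and zero: "\<And>k. (LINT x|lebesgue_on {0<..<pi}. f x * of_real (sin (real (Suc k) * x))) = 0"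
  shows "AE x in lebesgue_on {0<..<pi}. f x = 0"
proof -
  let ?M = "lebesgue_on {0<..<pi}"
  have int: "integrable ?M (\<lambda>x. f x * of_real (\<phi> x))" if "continuous_on UNIV \<phi>" for \<phi>
  proof -
    have "compact (\<phi> ` {0..pi})"
      using that by (intro compact_continuous_image continuous_on_subset[OF that]) auto
    then obtain C where "\<And>x. x \<in> {0..pi} \<Longrightarrow> \<bar>\<phi> x\<bar> \<le> C"
      by (metis compact_imp_bounded bounded_iff imageI real_norm_def)
    then show ?thesis using f that by (intro integrable_mult_bounded_continuous[where C = C]) auto
  qed
  \<comment> \<open>\<open>cos x * sin (k * x)\<close> is half the sum of
    \<open>sin ((k + 1) * x)\<close> and \<open>sin ((k - 1) * x)\<close>, so a power of the cosine
    is traded for neighbouring frequencies; frequency 0 is harmless because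
    \<open>sin 0 = 0\<close>.\<close>
  have cos_sin: "(LINT x|?M. f x * of_real (cos x ^ n * sin (real k * x))) = 0" for n k
  proof (induction n arbitrary: k)
    case 0
    then show ?case using zero[of "k - 1"] by (cases k) auto
  next
    case (Suc n)
    show ?case
    proof (cases k)
      case (Suc i)
      have "f x * of_real (cos x ^ Suc n * sin (real k * x))
          = (f x * of_real (cos x ^ n * sin (real (Suc k) * x)) + f x * of_real (cos x ^ n * sin (real i * x))) / 2" for x
      proof -
        have "cos x * sin (real k * x) = (sin (real (Suc k) * x) + sin (real i * x)) / 2"
        proof -
          have "real (Suc k) * x = real k * x + x" "real i * x = real k * x - x"
            using Suc by (simp_all add: algebra_simps)
          then show ?thesis by (simp only: sin_add sin_diff) simp
        qed
        then have "cos x ^ Suc n * sin (real k * x) = cos x ^ n * ((sin (real (Suc k) * x) + sin (real i * x)) / 2)"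
          by (simp only: power_Suc2 mult.assoc)
        then show ?thesis by (simp only: of_real_mult of_real_divide of_real_add) (simp add: distrib_left)
      qed
      then have "(LINT x|?M. f x * of_real (cos x ^ Suc n * sin (real k * x)))
          = ((LINT x|?M. f x * of_real (cos x ^ n * sin (real (Suc k) * x))) + (LINT x|?M. f x * of_real (cos x ^ n * sin (real i * x)))) / 2"
        by (simp only: integral_divide_zero)
          (subst Bochner_Integration.integral_add, auto intro!: int continuous_intros simp del: of_real_mult of_real_power)
      then show ?thesis by (simp only: Suc.IH) simp
    qed auto
  qed
  have "(LINT x|?M. \<psi> x *\<^sub>R (f x * of_real (sin x))) = 0" if \<psi>: "continuous_on UNIV \<psi>" for \<psi> :: "real \<Rightarrow> real"
  proof -
    let ?I = "LINT x|?M. \<psi> x *\<^sub>R (f x * of_real (sin x))"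
    define N where "N = (LINT x|?M. norm (f x))"
    have N: "0 \<le> N" by (simp add: N_def)
    have "norm ?I \<le> e * N" if e: "e > 0" for e
    proof -
      have "continuous_on {-1..1} (\<lambda>y. \<psi> (arccos y))"
        by (intro continuous_on_compose2[OF \<psi>] continuous_on_arccos' continuous_on_id) auto
      from Stone_Weierstrass_real_polynomial_function[OF compact_Icc this e]
      obtain p where p: "real_polynomial_function p" "\<And>y. y \<in> {-1..1} \<Longrightarrow> \<bar>\<psi> (arccos y) - p y\<bar> < e"
        by metis
      obtain a n where pa: "p = (\<lambda>x. \<Sum>i\<le>n. a i * x ^ i)"
        using p(1) unfolding real_polynomial_function_iff_sum by blast
      have pc: "continuous_on UNIV (\<lambda>x. p (cos x))" unfolding pa by (intro continuous_intros)
      have "(LINT x|?M. f x * of_real (p (cos x) * sin x)) = (LINT x|?M. (\<Sum>i\<le>n. of_real (a i) * (f x * of_real (cos x ^ i * sin (real 1 * x)))))"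
        by (intro Bochner_Integration.integral_cong) (simp_all add: pa sum_distrib_left sum_distrib_right mult_ac)
      also have "\<dots> = 0"
      proof (subst Bochner_Integration.integral_sum)
        show "integrable ?M (\<lambda>x. of_real (a i) * (f x * of_real (cos x ^ i * sin (real 1 * x))))" for i
          by (intro integrable_mult_right int continuous_intros)
        show "(\<Sum>i\<le>n. LINT x|?M. of_real (a i) * (f x * of_real (cos x ^ i * sin (real 1 * x)))) = 0"
          by (simp only: integral_mult_right_zero cos_sin[of _ 1] mult_zero_right sum.neutral_const)
      qed
      finally have p0: "(LINT x|?M. f x * of_real (p (cos x) * sin x)) = 0" .
      have "?I = (LINT x|?M. f x * of_real (\<psi> x * sin x)) - (LINT x|?M. f x * of_real (p (cos x) * sin x))"
        unfolding p0 by (simp add: scaleR_conv_of_real mult_ac)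
      also have "\<dots> = (LINT x|?M. f x * of_real (\<psi> x * sin x) - f x * of_real (p (cos x) * sin x))"
        by (intro Bochner_Integration.integral_diff[symmetric] int continuous_intros \<psi> pc)
      finally have "norm ?I \<le> (LINT x|?M. norm (f x * of_real (\<psi> x * sin x) - f x * of_real (p (cos x) * sin x)))"
        by simp
      also have "\<dots> \<le> (LINT x|?M. e * norm (f x))"
      proof (rule integral_mono)
        show "integrable ?M (\<lambda>x. norm (f x * of_real (\<psi> x * sin x) - f x * of_real (p (cos x) * sin x)))"
          by (intro integrable_norm Bochner_Integration.integrable_diff int continuous_intros \<psi> pc)
        show "integrable ?M (\<lambda>x. e * norm (f x))" using f by simp
        fix x assume "x \<in> space ?M"
        then have x: "0 < x" "x < pi" by auto
        have "\<bar>\<psi> x - p (cos x)\<bar> \<le> e" using p(2)[of "cos x"] x by (simp add: arccos_cos less_imp_le)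
        then have "\<bar>\<psi> x - p (cos x)\<bar> * \<bar>sin x\<bar> \<le> e * 1" by (intro mult_mono) auto
        moreover have "f x * of_real (\<psi> x * sin x) - f x * of_real (p (cos x) * sin x) = f x * of_real ((\<psi> x - p (cos x)) * sin x)"
          by (simp add: algebra_simps)
        ultimately show "norm (f x * of_real (\<psi> x * sin x) - f x * of_real (p (cos x) * sin x)) \<le> e * norm (f x)"
          by (simp only: norm_mult norm_of_real abs_mult) (metis mult.commute mult.right_neutral mult_left_mono norm_ge_zero)
      qed
      also have "\<dots> = e * N" by (simp add: N_def)
      finally show ?thesis .
    qed
    note * = this
    have "norm ?I \<le> 0 + e" if "e > 0" for e
    proof -
      \<comment> \<open>\<open>N + 1\<close> instead of \<open>N\<close> also covers
        \<open>N = 0\<close>.\<close>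
      have "e / (N + 1) * N \<le> e" using that N by (simp add: field_simps)
      then show ?thesis using *[of "e / (N + 1)"] that N by simp
    qed
    then have "norm ?I \<le> 0" by (rule field_le_epsilon)
    then show ?thesis by simp
  qed
  then have "AE x in ?M. f x * of_real (sin x) = 0"
    by (intro AE_zero_if_orthogonal_continuous int continuous_intros) auto
  then show ?thesis
    by (rule AE_mp) (auto intro!: AE_I2, metis sin_gt_zero less_irrefl)
qed

section \<open>Orthogonality of the sines and Parseval's identity\<close>

lemma has_integral_cos_nat:
  "((\<lambda>x. cos (real n * x)) has_integral (if n = 0 then pi else 0)) {0..pi}"
proof (cases "n = 0")
  case True
  then show ?thesis using has_integral_const_real[of "1::real" 0 pi] by simp
next
  case False
  have "((\<lambda>x. cos (real n * x)) has_integral (sin (real n * pi) / n - sin (real n * 0) / n)) {0..pi}"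
    using False
    by (intro fundamental_theorem_of_calculus)
      (auto intro!: derivative_eq_intros simp flip: has_real_derivative_iff_has_vector_derivative)
  then show ?thesis using False by (simp add: sin_npi)
qed

lemma has_integral_sin_mult_sin:
  fixes j k :: nat
  assumes "1 \<le> j" "1 \<le> k"
  shows "((\<lambda>x. sin (real j * x) * sin (real k * x)) has_integral (if j = k then pi / 2 else 0)) {0..pi}"
proof -
  \<comment> \<open>Assuming \<open>j \<le> k\<close> keeps the natural number subtraction
    \<open>k - j\<close> in the product formula exact; the other case follows by symmetry.\<close>
  have *: "((\<lambda>x. sin (real j * x) * sin (real k * x)) has_integral (if j = k then pi / 2 else 0)) {0..pi}"
    if "1 \<le> j" "j \<le> k" for j k :: nat
  proof -
    have "((\<lambda>x. (cos (real (k - j) * x) - cos (real (j + k) * x)) / 2) has_integral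
        ((if k - j = 0 then pi else 0) - (if j + k = 0 then pi else 0)) / 2) {0..pi}"
      by (intro has_integral_divide has_integral_diff has_integral_cos_nat)
    moreover have "(cos (real (k - j) * x) - cos (real (j + k) * x)) / 2 = sin (real j * x) * sin (real k * x)" for x
    proof -
      have "real (k - j) * x = real k * x - real j * x" "real (j + k) * x = real k * x + real j * x"
        using that by (simp_all add: of_nat_diff algebra_simps)
      then show ?thesis by (simp only: cos_add cos_diff) simp
    qed
    ultimately show ?thesis using that by (simp split: if_splits)
  qed
  show ?thesis
    using *[of j k] *[of k j] assms by (cases "j \<le> k") (auto simp: mult.commute)
qed

lemma integral_sin_mult_sin:
  fixes j k :: nat
  assumes "1 \<le> j" "1 \<le> k"
  shows "(LINT x|lebesgue_on {0<..<pi}. of_real (sin (real j * x)) * of_real (sin (real k * x)))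
      = (if j = k then of_real (pi / 2) else (0::complex))"
proof -
  interpret finite_measure "lebesgue_on {0<..<pi}" by (rule finite_measure_lebesgue_on) simp
  have m: "(\<lambda>x. sin (real j * x) * sin (real k * x)) \<in> borel_measurable (lebesgue_on {0<..<pi})"
    by (intro measurable_restrict_space1 borel_measurable_lebesgue_if_continuous continuous_intros)
  have "integrable (lebesgue_on {0<..<pi}) (\<lambda>x. sin (real j * x) * sin (real k * x))"
    by (rule integrable_const_bound[of _ 1, OF _ m]) (auto simp: abs_mult intro!: mult_le_one)
  then have "((\<lambda>x. sin (real j * x) * sin (real k * x)) has_integral
      (LINT x|lebesgue_on {0<..<pi}. sin (real j * x) * sin (real k * x))) {0<..<pi}"
    by (rule has_integral_integral_lebesgue_on) simp
  moreover have "((\<lambda>x. sin (real j * x) * sin (real k * x)) has_integral (if j = k then pi / 2 else 0)) {0<..<pi}"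
    using has_integral_sin_mult_sin[OF assms] by (simp add: has_integral_Icc_iff_Ioo)
  ultimately have "(LINT x|lebesgue_on {0<..<pi}. sin (real j * x) * sin (real k * x)) = (if j = k then pi / 2 else 0)"
    by (rule has_integral_unique)
  then have "(LINT x|lebesgue_on {0<..<pi}. complex_of_real (sin (real j * x) * sin (real k * x)))
      = of_real (if j = k then pi / 2 else 0)"
    by (simp only: integral_complex_of_real)
  then show ?thesis
    by (cases "j = k") (simp_all only: of_real_mult of_real_0 if_True if_False simp_thms)
qed

text \<open>Absolute summability of \<open>b\<close> justifies termwise integration. It is applied
  with \<open>f\<close> constant 1, with a sine, and with the given function.\<close>

lemma integral_mult_sine_series:
  fixes f :: "real \<Rightarrow> complex" and b :: "nat \<Rightarrow> complex"
  assumes f: "integrable (lebesgue_on S) f" and b: "summable (\<lambda>k. norm (b k))"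
  shows "integrable (lebesgue_on S) (\<lambda>x. f x * (\<Sum>k. b k * of_real (sin (real (Suc k) * x))))" (is ?int)
    and "(\<lambda>k. b k * (LINT x|lebesgue_on S. f x * of_real (sin (real (Suc k) * x))))
      sums (LINT x|lebesgue_on S. f x * (\<Sum>k. b k * of_real (sin (real (Suc k) * x))))" (is ?sums)
proof -
  let ?t = "\<lambda>k x. b k * (f x * of_real (sin (real (Suc k) * x)))"
  have int: "integrable (lebesgue_on S) (\<lambda>x. f x * of_real (sin (real (Suc k) * x)))" for k
    by (rule integrable_mult_bounded_continuous[OF f, of _ 1]) (auto intro!: continuous_intros)
  have i: "integrable (lebesgue_on S) (?t k)" for k
    using int by (rule integrable_mult_right)
  have le: "norm (?t k x) \<le> norm (b k) * norm (f x)" for k x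
    unfolding norm_mult norm_of_real by (intro mult_left_mono mult_left_le) auto
  have s1: "AE x in lebesgue_on S. summable (\<lambda>k. norm (?t k x))"
  proof (rule AE_I2)
    fix x
    have "summable (\<lambda>k. norm (b k) * norm (f x))" using b by (rule summable_mult2)
    then show "summable (\<lambda>k. norm (?t k x))"
      by (rule summable_comparison_test'[of _ 0]) (use le in simp)
  qed
  have s2: "summable (\<lambda>k. LINT x|lebesgue_on S. norm (?t k x))"
  proof (rule summable_comparison_test'[of "\<lambda>k. norm (b k) * (LINT x|lebesgue_on S. norm (f x))" 0])
    show "summable (\<lambda>k. norm (b k) * (LINT x|lebesgue_on S. norm (f x)))" using b by (rule summable_mult2)
    fix k
    have "(LINT x|lebesgue_on S. norm (?t k x)) \<le> (LINT x|lebesgue_on S. norm (b k) * norm (f x))"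
      by (rule integral_mono[OF integrable_norm[OF i] integrable_mult_right[OF integrable_norm[OF f]] le])
    then show "norm (LINT x|lebesgue_on S. norm (?t k x)) \<le> norm (b k) * (LINT x|lebesgue_on S. norm (f x))"
      by simp
  qed
  have eq: "(\<Sum>k. ?t k x) = f x * (\<Sum>k. b k * of_real (sin (real (Suc k) * x)))" for x
  proof -
    have "summable (\<lambda>k. b k * of_real (sin (real (Suc k) * x)))"
      by (rule summable_norm_cancel[OF summable_comparison_test'[OF b, of 0]])
        (auto simp: norm_mult intro!: mult_left_le)
    then show ?thesis by (subst suminf_mult[symmetric]) (simp_all add: mult_ac)
  qed
  show ?int using integrable_suminf[OF i s1 s2] unfolding eq .
  show ?sums using sums_integral[OF i s1 s2] unfolding eq integral_mult_right_zero .
qed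

lemma square_integrable_imp_integrable:
  assumes S: "S \<in> lmeasurable" and f: "square_integrable_on S f"
  shows "integrable (lebesgue_on S) f"
proof -
  interpret finite_measure "lebesgue_on S" by (rule finite_measure_lebesgue_on[OF S])
  show ?thesis
  proof (rule Bochner_Integration.integrable_bound)
    show "integrable (lebesgue_on S) (\<lambda>x. 1 + (norm (f x))\<^sup>2)"
      using f by (simp add: square_integrable_on_def)
    show "f \<in> borel_measurable (lebesgue_on S)" using f by (simp add: square_integrable_on_def)
    have "y \<le> 1 + y\<^sup>2" if "0 \<le> y" for y :: real
      using that by (cases "y \<le> 1") (auto simp: power2_eq_square intro: order_trans[of y "y * y"] add_increasing2)
    then show "AE x in lebesgue_on S. norm (f x) \<le> norm (1 + (norm (f x))\<^sup>2)"
      by (intro AE_I2) auto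
  qed
qed

text \<open>Absolute summability makes the sine series an honest integrable function
  \<open>G\<close> with the same coefficients as \<open>f\<close>, so completeness gives
  \<open>f = G\<close> almost everywhere. Replacing only the conjugate factor in
  \<open>f x * cnj (f x)\<close> by its series and integrating termwise gives the identity.\<close>

lemma sine_parseval:
  fixes f :: "real \<Rightarrow> complex"
  assumes f: "square_integrable_on {0<..<pi} f"
    and b: "summable (\<lambda>k. norm (sine_coeff f (Suc k)))"
  shows "(\<lambda>k. (norm (sine_coeff f (Suc k)))\<^sup>2) sums (2 / pi * (L2_norm_on {0<..<pi} f)\<^sup>2)"
proof -
  let ?M = "lebesgue_on {0<..<pi}"
  define B where "B k = sine_coeff f (Suc k)" for k
  define G where "G x = (\<Sum>k. B k * of_real (sin (real (Suc k) * x)))" for x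
  have b': "summable (\<lambda>k. norm (B k))" using b by (simp add: B_def)
  have f1: "integrable ?M f" by (rule square_integrable_imp_integrable[OF _ f]) simp
  interpret finite_measure ?M by (rule finite_measure_lebesgue_on) simp
  have G1: "integrable ?M G"
    using integral_mult_sine_series(1)[of "{0<..<pi}" "\<lambda>_. 1", OF _ b'] by (simp add: G_def[abs_def])
  have int_sin: "integrable ?M (\<lambda>x. h x * of_real (sin (real (Suc k) * x)))" if "integrable ?M h" for h :: "real \<Rightarrow> complex" and k
    by (rule integrable_mult_bounded_continuous[OF that, of _ 1]) (auto intro!: continuous_intros)
  have coeff: "(LINT x|?M. f x * of_real (sin (real (Suc k) * x))) = of_real (pi / 2) * B k" for k
    by (simp add: B_def sine_coeff_def flip: of_real_mult)
  have "(LINT x|?M. (f x - G x) * of_real (sin (real (Suc j) * x))) = 0" for j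
  proof -
    have s: "integrable ?M (\<lambda>x. complex_of_real (sin (real (Suc j) * x)))"
      using int_sin[of "\<lambda>_. 1" j] by simp
    have "(\<lambda>k. B k * (LINT x|?M. of_real (sin (real (Suc j) * x)) * of_real (sin (real (Suc k) * x))))
        sums (LINT x|?M. of_real (sin (real (Suc j) * x)) * G x)"
      unfolding G_def by (rule integral_mult_sine_series(2)[OF s b'])
    also have "(\<lambda>k. B k * (LINT x|?M. of_real (sin (real (Suc j) * x)) * of_real (sin (real (Suc k) * x))))
        = (\<lambda>k. if k = j then of_real (pi / 2) * B j else 0)"
      by (auto simp: integral_sin_mult_sin simp del: of_nat_Suc)
    finally have "(LINT x|?M. of_real (sin (real (Suc j) * x)) * G x) = of_real (pi / 2) * B j"
      by (rule sums_unique2[OF _ sums_single])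
    then have GG: "(LINT x|?M. G x * of_real (sin (real (Suc j) * x))) = of_real (pi / 2) * B j"
      unfolding mult.commute[of "G _"] .
    show ?thesis
      unfolding left_diff_distrib
      by (subst Bochner_Integration.integral_diff[OF int_sin[OF f1] int_sin[OF G1]]) (simp only: coeff GG diff_self)
  qed
  then have "AE x in ?M. f x - G x = 0"
    by (intro AE_zero_if_sine_coeff_zero Bochner_Integration.integrable_diff f1 G1)
  then have fG: "AE x in ?M. f x * cnj (f x) = f x * (\<Sum>k. cnj (B k) * of_real (sin (real (Suc k) * x)))"
  proof eventually_elim
    case (elim x)
    have "cnj (G x) = (\<Sum>k. cnj (B k * of_real (sin (real (Suc k) * x))))"
      unfolding G_def
      by (intro bounded_linear.suminf[OF bounded_linear_cnj] summable_norm_cancel[OF summable_comparison_test'[OF b', of 0]])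
        (auto simp: norm_mult intro!: mult_left_le)
    moreover have "f x = G x" using elim by simp
    ultimately show ?case by simp
  qed
  have b'': "summable (\<lambda>k. norm (cnj (B k)))" using b' by simp
  have "(\<lambda>x. f x * cnj (f x)) \<in> borel_measurable ?M"
    using borel_measurable_integrable[OF f1] unfolding complex_norm_square[symmetric] by measurable
  then have "(LINT x|?M. f x * cnj (f x)) = (LINT x|?M. f x * (\<Sum>k. cnj (B k) * of_real (sin (real (Suc k) * x))))"
    using fG borel_measurable_integrable[OF integral_mult_sine_series(1)[OF f1 b'']]
    by (intro integral_cong_AE)
  then have "(\<lambda>k. cnj (B k) * (of_real (pi / 2) * B k)) sums (LINT x|?M. f x * cnj (f x))"
    using integral_mult_sine_series(2)[OF f1 b''] unfolding coeff by simp
  also have "(\<lambda>k. cnj (B k) * (of_real (pi / 2) * B k)) = (\<lambda>k. of_real (pi / 2 * (norm (B k))\<^sup>2))"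
    by (simp only: of_real_mult complex_norm_square mult_ac)
  also have "(LINT x|?M. f x * cnj (f x)) = (LINT x|?M. of_real ((norm (f x))\<^sup>2))"
    by (simp only: complex_norm_square)
  also have "\<dots> = of_real (LINT x|?M. (norm (f x))\<^sup>2)" by (rule integral_complex_of_real)
  finally have "(\<lambda>k. pi / 2 * (norm (B k))\<^sup>2) sums (LINT x|?M. (norm (f x))\<^sup>2)"
    by (simp only: sums_of_real_iff)
  then have "(\<lambda>k. 2 / pi * (pi / 2 * (norm (B k))\<^sup>2)) sums (2 / pi * (LINT x|?M. (norm (f x))\<^sup>2))"
    by (rule sums_mult)
  then show ?thesis by (simp add: L2_norm_on_def B_def)
qed

section \<open>Logarithmic stability\<close>

text \<open>The intervals from \<open>q\<close> to \<open>3 * q / 2\<close> with rational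
  \<open>q > 0\<close> cover all positive times, and countably many null pieces cannot make up
  \<open>B\<close>. The length \<open>a / 2\<close> is what makes the interpolation ratio
  \<open>h / a\<close> equal to one half.\<close>

lemma positive_measure_on_interval_off_zero:
  fixes B :: "real set"
  assumes B: "B \<in> sets lebesgue" "emeasure lebesgue B > 0" "B \<subseteq> {0..}"
  shows "\<exists>a>0. 0 < measure lebesgue (B \<inter> {a..a + a / 2})"
proof (rule ccontr)
  assume none: "\<not> ?thesis"
  have null: "B \<inter> {a..a + a / 2} \<in> null_sets lebesgue" if "0 < a" for a
  proof -
    have "\<not> 0 < measure lebesgue (B \<inter> {a..a + a / 2})" using none that by blast
    then have "measure lebesgue (B \<inter> {a..a + a / 2}) = 0"
      using measure_nonneg[of lebesgue "B \<inter> {a..a + a / 2}"] by linarith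
    moreover have lm: "B \<inter> {a..a + a / 2} \<in> lmeasurable"
      using B(1) by (intro bounded_set_imp_lmeasurable) (auto intro: bounded_subset[of "{a..a + a / 2}"])
    ultimately show ?thesis by (simp add: null_sets_def emeasure_eq_measure2 fmeasurableD)
  qed
  have "B \<subseteq> {0} \<union> (\<Union>q\<in>\<rat> \<inter> {0<..}. B \<inter> {q..q + q / 2})"
  proof
    fix x assume x: "x \<in> B"
    show "x \<in> {0} \<union> (\<Union>q\<in>\<rat> \<inter> {0<..}. B \<inter> {q..q + q / 2})"
    proof (cases "x = 0")
      case False
      then have "0 < x" using x B(3) by auto
      then obtain q where "q \<in> \<rat>" "2 * x / 3 < q" "q < x" using Rats_dense_in_real[of "2 * x / 3" x] by auto
      moreover from this have "x \<in> B \<inter> {q..q + q / 2}" "q \<in> \<rat> \<inter> {0<..}"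
        using x \<open>0 < x\<close> by auto
      ultimately show ?thesis by blast
    qed auto
  qed
  moreover have "{0} \<union> (\<Union>q\<in>\<rat> \<inter> {0<..}. B \<inter> {q..q + q / 2}) \<in> null_sets lebesgue"
    using null by (intro null_sets.Un null_sets_UN') (auto intro: countable_rat countable_Int1)
  ultimately have "B \<in> null_sets lebesgue" using B(1) null_sets_subset by blast
  then show False using B(2) by auto
qed

text \<open>Balancing in \<open>N\<close>: let \<open>N\<close> tend to infinity if
  \<open>\<epsilon> = 0\<close>, take \<open>N = 1\<close> if \<open>\<epsilon>\<close> is not
  small, and otherwise \<open>N\<^sup>2\<close> of the order of \<open>- ln \<epsilon>\<close>.
  \<open>C'\<close> adds the constants of the last two cases.\<close>

lemma log_rate_of_exponential_tradeoff:
  fixes C b :: real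
  assumes "0 < C" "0 < b"
  shows "\<exists>C'>0. \<forall>y \<epsilon>. 0 \<le> \<epsilon> \<longrightarrow> (\<forall>N::nat. 1 \<le> N \<longrightarrow> y \<le> C * (1 / (real N)\<^sup>2 + \<epsilon> * exp (b * (real N)\<^sup>2)))
      \<longrightarrow> y \<le> (if \<epsilon> = 0 then 0 else C' * (1 / \<bar>ln \<epsilon>\<bar> + \<epsilon>))"
proof -
  define C' where "C' = C * (8 * b + 2) + C * (exp (2 * b) + exp b)"
  have C'1: "C * (8 * b + 2) \<le> C'" "C * (exp (2 * b) + exp b) \<le> C'"
    using assms by (auto simp: C'_def)
  have C': "0 < C'" unfolding C'_def using assms by (intro add_pos_pos mult_pos_pos) auto
  have "y \<le> (if \<epsilon> = 0 then 0 else C' * (1 / \<bar>ln \<epsilon>\<bar> + \<epsilon>))"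
    if \<epsilon>: "0 \<le> \<epsilon>" and *: "\<And>N::nat. 1 \<le> N \<Longrightarrow> y \<le> C * (1 / (real N)\<^sup>2 + \<epsilon> * exp (b * (real N)\<^sup>2))" for y \<epsilon>
  proof (cases "\<epsilon> = 0")
    case True
    have "(\<lambda>N. C * (1 / (real N)\<^sup>2)) \<longlonglongrightarrow> C * 0"
      by (intro tendsto_mult tendsto_const) real_asymp
    then have "y \<le> C * 0"
      using *[unfolded True] by (intro LIMSEQ_le_const[of _ _ y]) auto
    then show ?thesis using True by simp
  next
    case False
    then have pos: "0 < \<epsilon>" using \<epsilon> by simp
    have nonneg: "0 \<le> 1 / \<bar>ln \<epsilon>\<bar>" by simp
    show ?thesis
    \<comment> \<open>At the threshold \<open>R\<close> below equals 1; under it the floor of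
      \<open>R\<close> is an admissible \<open>N\<close>. Above it only the
      \<open>\<epsilon>\<close> term of the bound is used, which covers
      \<open>\<epsilon> = 1\<close>, where \<open>1 / \<bar>ln \<epsilon>\<bar>\<close> is
      \<open>1 / 0 = 0\<close>.\<close>
    proof (cases "exp (- (2 * b)) \<le> \<epsilon>")
      case True
      have "1 = exp (2 * b) * exp (- (2 * b))" by (simp flip: exp_add)
      also have "\<dots> \<le> exp (2 * b) * \<epsilon>" using True by (intro mult_left_mono) auto
      finally have "C * (1 + \<epsilon> * exp b) \<le> C * (exp (2 * b) * \<epsilon> + \<epsilon> * exp b)"
        using assms by (intro mult_left_mono) auto
      also have "\<dots> = C * (exp (2 * b) + exp b) * \<epsilon>" by (simp add: algebra_simps)
      also have "\<dots> \<le> C' * \<epsilon>" using C'1 pos by (intro mult_right_mono) auto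
      also have "\<dots> \<le> C' * (1 / \<bar>ln \<epsilon>\<bar> + \<epsilon>)" using C' nonneg by (intro mult_left_mono) auto
      finally show ?thesis using *[of 1] False by simp
    next
      case small: False
      define L where "L = - ln \<epsilon>"
      have "ln \<epsilon> < ln (exp (- (2 * b)))" using small pos by (subst ln_less_cancel_iff) auto
      then have L: "2 * b < L" by (simp add: L_def)
      then have L0: "0 < L" using assms by simp
      have eL: "\<epsilon> = exp (- L)" using pos by (simp add: L_def)
      \<comment> \<open>\<open>b * R\<^sup>2 = L / 2\<close> spends only half of the smallness of
        \<open>\<epsilon>\<close>; the other half leaves
        \<open>exp (- (L / 2)) \<le> 2 / L\<close>.\<close>
      define R where "R = sqrt (L / (2 * b))"
      have R2: "R\<^sup>2 = L / (2 * b)" using L0 assms by (simp add: R_def)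
      have R1: "1 < R" using L assms by (simp add: R_def)
      define N where "N = nat \<lfloor>R\<rfloor>"
      have N: "1 \<le> N" "real N \<le> R" "R < real N + 1"
      proof -
        have "1 \<le> \<lfloor>R\<rfloor>" using R1 by (simp add: le_floor_iff)
        then have "real N = of_int \<lfloor>R\<rfloor>" "1 \<le> N" unfolding N_def by linarith+
        then show "1 \<le> N" "real N \<le> R" "R < real N + 1" by linarith+
      qed
      have "(real N)\<^sup>2 \<le> L / (2 * b)" using power_mono[OF N(2), of 2] R2 by simp
      then have bN: "b * (real N)\<^sup>2 \<le> L / 2" using assms by (simp add: field_simps)
      have "1 \<le> real N" using N(1) by simp
      \<comment> \<open>Rounding loses a factor 2, hence 4 after squaring; this is the origin of
        \<open>8 * b\<close>.\<close>
      then have "R \<le> 2 * real N" using N(3) by linarith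
      then have "R\<^sup>2 \<le> (2 * real N)\<^sup>2" using R1 by (intro power_mono) auto
      then have "L / (2 * b) \<le> 4 * (real N)\<^sup>2" unfolding R2 by (simp add: power_mult_distrib)
      then have iN: "1 / (real N)\<^sup>2 \<le> 8 * b / L" using N(1) assms L0 by (simp add: field_simps)
      have "\<epsilon> * exp (b * (real N)\<^sup>2) \<le> exp (- L) * exp (L / 2)"
        unfolding eL using bN by (intro mult_left_mono) auto
      also have "\<dots> = exp (- (L / 2))" by (simp flip: exp_add)
      also have "\<dots> = 1 / exp (L / 2)" by (simp add: exp_minus inverse_eq_divide)
      also have "\<dots> \<le> 1 / (L / 2)"
      proof (intro divide_left_mono)
        show "L / 2 \<le> exp (L / 2)" using exp_ge_add_one_self[of "L / 2"] by linarith
      qed (use L0 in auto)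
      finally have "C * (1 / (real N)\<^sup>2 + \<epsilon> * exp (b * (real N)\<^sup>2)) \<le> C * (8 * b / L + 2 / L)"
        using iN assms by (intro mult_left_mono add_mono) auto
      also have "\<dots> = C * (8 * b + 2) * (1 / L)" by (simp add: add_divide_distrib distrib_left)
      also have "\<dots> \<le> C' * (1 / L)" using C'1 L0 by (intro mult_right_mono) auto
      also have "\<dots> \<le> C' * (1 / \<bar>ln \<epsilon>\<bar> + \<epsilon>)" using C' L0 pos by (intro mult_left_mono) (auto simp: L_def)
      finally show ?thesis using *[OF N(1)] False by simp
    qed
  qed
  then show ?thesis using C' by blast
qed

section \<open>From the Sobolev data to absolutely convergent series\<close>

lemma bij_betw_Suc_atLeast_1: "bij_betw Suc UNIV {1::nat..}"
  by (rule bij_betwI[of _ _ _ "\<lambda>n. n - 1"]) auto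

lemma japanese_bracket_powr_4: "japanese_bracket y powr (2 * 2) = (1 + y\<^sup>2)\<^sup>2"
proof -
  have pos: "0 < 1 + y\<^sup>2" by (simp add: add_pos_nonneg)
  have "japanese_bracket y powr (2 * 2) = japanese_bracket y powr 4" by simp
  also have "\<dots> = sqrt (1 + y\<^sup>2) ^ 4"
    unfolding japanese_bracket_def using pos by (intro powr_numeral) simp
  also have "\<dots> = ((sqrt (1 + y\<^sup>2))\<^sup>2)\<^sup>2" by (simp only: power_mult[symmetric]) simp
  also have "(sqrt (1 + y\<^sup>2))\<^sup>2 = 1 + y\<^sup>2" using pos by (intro real_sqrt_pow2) simp
  finally show ?thesis .
qed

text \<open>Turns unordered sums over \<open>{1..}\<close> into series indexed from 0; from here on
  the mode \<open>k + 1\<close> sits at index \<open>k\<close>.\<close>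

lemma sine_sobolev_2_summable:
  assumes h: "h \<in> sine_sobolev 2" and m: "sine_sobolev_norm 2 h \<le> m"
  defines "W \<equiv> \<lambda>k. (1 + (real (Suc k))\<^sup>2)\<^sup>2 * (norm (sine_coeff h (Suc k)))\<^sup>2"
  shows "summable W" "suminf W \<le> m\<^sup>2"
proof -
  define V where "V k = japanese_bracket (real k) powr (2 * 2) * (norm (sine_coeff h k))\<^sup>2" for k
  have WV: "W = (\<lambda>k. V (Suc k))" by (simp only: W_def V_def japanese_bracket_powr_4)
  have "V summable_on {1..}" using h by (simp add: sine_sobolev_def V_def[abs_def])
  then have so: "W summable_on UNIV"
    unfolding WV by (subst summable_on_reindex_bij_betw[OF bij_betw_Suc_atLeast_1])
  then show s: "summable W" by (rule summable_on_imp_summable)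
  have W0: "0 \<le> W k" for k by (simp add: W_def)
  have "infsum V {1..} = infsum W UNIV"
    unfolding WV by (rule infsum_reindex_bij_betw[OF bij_betw_Suc_atLeast_1, symmetric])
  also have "\<dots> = suminf W"
    by (rule sums_unique[OF has_sum_imp_sums[OF has_sum_infsum[OF so]]])
  finally have "sine_sobolev_norm 2 h = sqrt (suminf W)"
    by (simp add: sine_sobolev_norm_def V_def[abs_def])
  then have "sqrt (suminf W) \<le> m" using m by simp
  moreover have "0 \<le> suminf W" using s W0 by (rule suminf_nonneg)
  ultimately have "(sqrt (suminf W))\<^sup>2 \<le> m\<^sup>2" by (intro power_mono) auto
  then show "suminf W \<le> m\<^sup>2" using \<open>0 \<le> suminf W\<close> by simp
qed

text \<open>Time 0 is included because \<open>B\<close> may contain it; there convergence rests on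
  the absolute summability of the coefficients alone.\<close>

lemma frac_heat_solution_suminf:
  fixes f :: "real \<Rightarrow> complex"
  assumes b: "summable (\<lambda>k. norm (sine_coeff f (Suc k)))" and "0 \<le> t"
  shows "frac_heat_solution \<alpha> f x t
    = (\<Sum>k. sine_coeff f (Suc k) * of_real (sin (real (Suc k) * x)) * of_real (exp (- (real (Suc k) powr (2 * \<alpha>)) * t)))"
proof -
  define u where "u k = of_real (exp (- (real k powr (2 * \<alpha>)) * t)) * sine_coeff f k * of_real (sin (real k * x))" for k
  have "norm (u (Suc k)) \<le> norm (sine_coeff f (Suc k))" for k
  proof -
    have "exp (- (real (Suc k) powr (2 * \<alpha>)) * t) * \<bar>sin (real (Suc k) * x)\<bar> \<le> 1 * 1"
      using assms(2) by (intro mult_mono) auto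
    moreover have "norm (u (Suc k)) = norm (sine_coeff f (Suc k))
        * (exp (- (real (Suc k) powr (2 * \<alpha>)) * t) * \<bar>sin (real (Suc k) * x)\<bar>)"
      unfolding u_def by (simp add: norm_mult)
    ultimately show ?thesis by (simp add: mult_left_le)
  qed
  then have s: "summable (\<lambda>k. norm (u (Suc k)))"
    by (intro summable_comparison_test'[OF b, of 0]) simp
  have "((\<lambda>k. u (Suc k)) has_sum (\<Sum>k. u (Suc k))) UNIV"
    by (rule norm_summable_imp_has_sum[OF s summable_sums[OF summable_norm_cancel[OF s]]])
  then have "infsum (\<lambda>k. u (Suc k)) UNIV = (\<Sum>k. u (Suc k))" by (rule infsumI)
  then have "infsum u {1..} = (\<Sum>k. u (Suc k))"
    by (simp only: infsum_reindex_bij_betw[OF bij_betw_Suc_atLeast_1])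
  then show ?thesis
    unfolding frac_heat_solution_def u_def by (simp add: mult_ac)
qed

lemma summable_inverse_Suc_squares: "summable (\<lambda>k. 1 / (real (Suc k))\<^sup>2)"
  using inverse_power_summable[of 2, where 'a = real] summable_Suc_iff[of "\<lambda>k. inverse ((real k)\<^sup>2)"]
    by (simp only: inverse_eq_divide le_refl)

text \<open>With \<open>K = Suc k\<close>, \<open>norm (b k)\<close> is the product of
  \<open>K\<^sup>2 * norm (b k)\<close> and \<open>1 / K\<^sup>2\<close>, so it is bounded by the
  sum of their squares. The total therefore depends on \<open>m\<close> only. In the tail the weight
  is at least \<open>N ^ 4\<close>.\<close>

lemma weighted_square_sum_bounds:
  fixes b :: "nat \<Rightarrow> complex"
  assumes W: "summable (\<lambda>k. (1 + (real (Suc k))\<^sup>2)\<^sup>2 * (norm (b k))\<^sup>2)"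
      "(\<Sum>k. (1 + (real (Suc k))\<^sup>2)\<^sup>2 * (norm (b k))\<^sup>2) \<le> m\<^sup>2"
  shows "summable (\<lambda>k. norm (b k))" "(\<Sum>k. norm (b k)) \<le> m\<^sup>2 + (\<Sum>k. 1 / (real (Suc k))\<^sup>2)"
    and "1 \<le> N \<Longrightarrow> (\<Sum>k. (norm (b (k + N)))\<^sup>2) \<le> (m / (real N)\<^sup>2)\<^sup>2"
proof -
  define V where "V k = (1 + (real (Suc k))\<^sup>2)\<^sup>2 * (norm (b k))\<^sup>2" for k
  have V: "summable V" "suminf V \<le> m\<^sup>2" using W by (simp_all only: V_def[abs_def])
  have V0: "0 \<le> V k" for k by (simp add: V_def)
  have Vge: "(real (Suc k))^4 * (norm (b k))\<^sup>2 \<le> V k" for k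
  proof -
    have "(real (Suc k))^4 = ((real (Suc k))\<^sup>2)\<^sup>2" by simp
    also have "\<dots> \<le> (1 + (real (Suc k))\<^sup>2)\<^sup>2" by (intro power_mono) auto
    finally show ?thesis unfolding V_def by (rule mult_right_mono) simp
  qed
  have inv: "summable (\<lambda>k. 1 / (real (Suc k))\<^sup>2)"
    by (rule summable_inverse_Suc_squares)
  have le: "norm (b k) \<le> V k + 1 / (real (Suc k))\<^sup>2" for k
  proof -
    define K where "K = real (Suc k)"
    have K: "1 \<le> K" by (simp add: K_def)
    have "(K\<^sup>2 * norm (b k)) * (1 / K\<^sup>2) = norm (b k)" using K by simp
    moreover have "0 \<le> (K\<^sup>2 * norm (b k))\<^sup>2 + (1 / K\<^sup>2)\<^sup>2" by simp
    ultimately have "norm (b k) \<le> (K\<^sup>2 * norm (b k))\<^sup>2 + (1 / K\<^sup>2)\<^sup>2"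
      using sum_squares_bound[of "K\<^sup>2 * norm (b k)" "1 / K\<^sup>2"] by linarith
    moreover have "(K\<^sup>2 * norm (b k))\<^sup>2 = K^4 * (norm (b k))\<^sup>2" by (simp add: power_mult_distrib)
    moreover have "(1 / K\<^sup>2)\<^sup>2 \<le> 1 / K\<^sup>2"
      using K power_decreasing[of 1 2 "1 / K\<^sup>2"] by simp
    ultimately show ?thesis using Vge[of k] unfolding K_def by linarith
  qed
  have sum2: "summable (\<lambda>k. V k + 1 / (real (Suc k))\<^sup>2)" using V(1) inv by (rule summable_add)
  show s: "summable (\<lambda>k. norm (b k))"
    by (rule summable_comparison_test'[OF sum2, of 0]) (use le in simp)
  have "(\<Sum>k. norm (b k)) \<le> (\<Sum>k. V k + 1 / (real (Suc k))\<^sup>2)" by (rule suminf_le[OF le s sum2])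
  also have "\<dots> = suminf V + (\<Sum>k. 1 / (real (Suc k))\<^sup>2)" by (rule suminf_add[OF V(1) inv, symmetric])
  finally show "(\<Sum>k. norm (b k)) \<le> m\<^sup>2 + (\<Sum>k. 1 / (real (Suc k))\<^sup>2)" using V(2) by linarith
  assume N: "1 \<le> N"
  have N4: "0 < (real N)^4" using N by simp
  have "(norm (b (k + N)))\<^sup>2 \<le> V (k + N) * (1 / (real N)^4)" for k
  proof -
    have "(real N)^4 * (norm (b (k + N)))\<^sup>2 \<le> (real (Suc (k + N)))^4 * (norm (b (k + N)))\<^sup>2"
      by (intro mult_right_mono power_mono) auto
    also have "\<dots> \<le> V (k + N)" by (rule Vge)
    finally show ?thesis using N4 by (simp add: field_simps)
  qed
  note tail = this
  have Vs: "summable (\<lambda>k. V (k + N))" using V(1) by (rule summable_ignore_initial_segment)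
  have Vs': "summable (\<lambda>k. V (k + N) * (1 / (real N)^4))" using Vs by (rule summable_mult2)
  have "(\<Sum>k. (norm (b (k + N)))\<^sup>2) \<le> (\<Sum>k. V (k + N) * (1 / (real N)^4))"
    by (rule suminf_le[OF tail _ Vs']) (rule summable_comparison_test'[OF Vs', of 0], use tail in simp)
  also have "\<dots> = (\<Sum>k. V (k + N)) * (1 / (real N)^4)" by (rule suminf_mult2[OF Vs, symmetric])
  also have "\<dots> \<le> m\<^sup>2 * (1 / (real N)^4)"
  proof (intro mult_right_mono)
    have "(\<Sum>k. V (k + N)) \<le> suminf V"
      using suminf_split_initial_segment[OF V(1), of N] V0 by (simp add: sum_nonneg)
    then show "(\<Sum>k. V (k + N)) \<le> m\<^sup>2" using V(2) by linarith
  qed simp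
  also have "\<dots> = (m / (real N)\<^sup>2)\<^sup>2" by (simp add: power_divide)
  finally show "(\<Sum>k. (norm (b (k + N)))\<^sup>2) \<le> (m / (real N)\<^sup>2)\<^sup>2" .
qed

text \<open>Joins the two mechanisms: smallness passes from \<open>B\<close> to an interval of
  length \<open>h\<close>, and shifts of total length at most \<open>h\<close> isolate the mode
  there. The constants are fixed before \<open>A\<close>, \<open>k\<close> and \<open>n\<close>, so
  \<open>n\<close> can later be adapted to the range of modes considered.\<close>

lemma exp_sum_coeff_small:
  fixes \<beta> :: real and B :: "real set"
  assumes \<beta>: "1 < \<beta>" "\<beta> < 2"
    and B: "B \<in> sets lebesgue" "emeasure lebesgue B > 0" "B \<subseteq> {0..}"
  obtains C D K where "0 < C" "0 < D" "0 < K"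
    "\<And>A M \<epsilon> k n. summable (\<lambda>k. norm (A k :: complex)) \<Longrightarrow> (\<Sum>k. norm (A k)) \<le> M \<Longrightarrow>
      (AE t in lebesgue_on B. norm (\<Sum>k. A k * of_real (exp (- (real (Suc k) powr \<beta>) * t))) \<le> \<epsilon>) \<Longrightarrow>
      norm (A k) \<le> C * exp (D * (real (Suc k))\<^sup>2) * (M * (1 / 2) ^ n + \<epsilon> * K ^ n)"
proof -
  obtain a where a: "0 < a" "0 < measure lebesgue (B \<inter> {a..a + a / 2})"
    using positive_measure_on_interval_off_zero[OF B] by blast
  define h where "h = a / 2"
  define E0 where "E0 = B \<inter> {a..a + h}"
  define s where "s = measure lebesgue E0"
  have h: "0 < h" "h \<le> a / 2" using a by (auto simp: h_def)
  have s: "0 < s" using a by (simp add: s_def E0_def h_def)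
  \<comment> \<open>The shifts are summable because \<open>1 < p\<close>, and \<open>l j * \<tau> j\<close> tends to infinity because \<open>p < \<beta>\<close>.\<close>
  define p where "p = (1 + \<beta>) / 2"
  have p: "1 < p" "p < \<beta>" using \<beta> by (auto simp: p_def)
  define l where "l k = real (Suc k) powr \<beta>" for k
  define Z where "Z = (\<Sum>k. real (Suc k) powr (- p))"
  have Zs: "summable (\<lambda>k. real (Suc k) powr (- p))"
    using p summable_real_powr_iff[of "- p"] by (subst summable_Suc_iff) simp
  have Z: "0 < Z" unfolding Z_def using Zs by (rule suminf_pos) simp
  \<comment> \<open>Scales the total shift to fit into the interval of length \<open>h\<close>; the
    cap 1 is required by \<open>shift_product_lower\<close>.\<close>
  define \<kappa> where "\<kappa> = min 1 (h / Z)"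
  have \<kappa>: "0 < \<kappa>" "\<kappa> \<le> 1" "\<kappa> * Z \<le> h"
    using h Z by (auto simp: \<kappa>_def min_def field_simps)
  define \<tau> where "\<tau> k = \<kappa> * real (Suc k) powr (- p)" for k
  have \<tau>_sum: "sum \<tau> F \<le> h" if "finite F" for F
  proof -
    have "sum \<tau> F = \<kappa> * (\<Sum>k\<in>F. real (Suc k) powr (- p))" by (simp add: \<tau>_def sum_distrib_left)
    also have "\<dots> \<le> \<kappa> * Z" unfolding Z_def using Zs \<kappa> that by (intro mult_left_mono sum_le_suminf) auto
    finally show ?thesis using \<kappa> by linarith
  qed
  define v where "v k = exp (- \<kappa> * real (Suc k) powr (\<beta> - p))" for k
  have v0: "0 \<le> v k" for k by (simp add: v_def)
  have vs: "summable v" unfolding v_def using \<kappa> p by (intro summable_exp_neg_powr) auto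
  have lv: "exp (- l j * \<tau> j) = v j" for j
    by (simp add: l_def \<tau>_def v_def powr_diff powr_minus field_simps)
  define Q where "Q = exp (suminf v)"
  have Q: "(\<Prod>j\<in>F. 1 + exp (- l j * \<tau> j)) \<le> Q" if "finite F" for F
  proof -
    have "(\<Prod>j\<in>F. 1 + v j) \<le> exp (sum v F)" by (rule prod_one_plus_le_exp_sum) (simp add: v_def)
    also have "\<dots> \<le> Q" unfolding Q_def using vs that v0 by (auto intro!: sum_le_suminf)
    finally show ?thesis unfolding lv .
  qed
  have "\<exists>c>0. \<exists>D. \<forall>k n. c * exp (- D * (real (Suc k))\<^sup>2)
      \<le> (\<Prod>j\<in>{..<n} - {k}. \<bar>exp (- l j * \<tau> j) - exp (- l k * \<tau> j)\<bar>)"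
    unfolding l_def \<tau>_def using \<tau>_sum \<beta> p \<kappa> unfolding \<tau>_def
    by (intro shift_product_lower) auto
  then obtain c D where c: "0 < c" and P: "\<And>k n. c * exp (- D * (real (Suc k))\<^sup>2)
      \<le> (\<Prod>j\<in>{..<n} - {k}. \<bar>exp (- l j * \<tau> j) - exp (- l k * \<tau> j)\<bar>)"
    by blast
  define K where "K = 2 * exp 1 * h / s"
  have K: "0 < K" using h s by (simp add: K_def)
  define C where "C = Q * exp 1 / c"
  have C: "0 < C" using c by (simp add: C_def Q_def)
  \<comment> \<open>\<open>a\<close> pays for \<open>exp (l k * a)\<close>, since
    \<open>l k \<le> (Suc k)\<^sup>2\<close>; the absolute value is there because \<open>D\<close>
    comes without a sign.\<close>
  define D' where "D' = a + \<bar>D\<bar>"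
  have D': "0 < D'" using a by (simp add: D'_def)
  have "norm (A k) \<le> C * exp (D' * (real (Suc k))\<^sup>2) * (M * (1 / 2) ^ n + \<epsilon> * K ^ n)"
    if A: "summable (\<lambda>k. norm (A k))" "(\<Sum>k. norm (A k)) \<le> M"
      and ae: "AE t in lebesgue_on B. norm (\<Sum>k. A k * of_real (exp (- (real (Suc k) powr \<beta>) * t))) \<le> \<epsilon>"
    for A :: "nat \<Rightarrow> complex" and M \<epsilon> k n
  proof -
    define g where "g t = (\<Sum>k. A k * of_real (exp (- l k * t)))" for t
    have "AE t in lebesgue. t \<in> B \<longrightarrow> norm (g t) \<le> \<epsilon>"
      using ae B(1) unfolding g_def l_def by (subst (asm) AE_restrict_space_iff) auto
    then obtain N where N: "N \<in> null_sets lebesgue" "\<And>t. t \<in> B - N \<Longrightarrow> norm (g t) \<le> \<epsilon>"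
      by (auto simp: eventually_ae_filter)
    \<comment> \<open>Interpolation evaluates \<open>g\<close> at single points, so the exceptional
      null set has to be removed; the measure is unchanged.\<close>
    define E where "E = E0 - N"
    have E0: "E0 \<in> sets lebesgue" unfolding E0_def using B(1) by (intro sets.Int) auto
    have E: "E \<in> sets lebesgue" "E \<subseteq> {a..a + h}" "s \<le> measure lebesgue E"
      using N(1) E0 measure_Diff_null_set[OF E0 N(1)] by (auto simp: E_def E0_def s_def)
    have small: "norm (g t) \<le> \<epsilon>" if "t \<in> E" for t using N(2)[of t] that by (auto simp: E_def E0_def)
    have "E \<noteq> {}" using E(3) s by auto
    then have \<epsilon>: "0 \<le> \<epsilon>" using small norm_ge_zero order_trans by (metis ex_in_conv)
    have M: "0 \<le> M" using A suminf_nonneg[OF A(1)] by simp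
    have l0: "0 \<le> l k" for k by (simp add: l_def)
    define G where "G = M * (1 / 2) ^ Suc n + \<epsilon> * (exp 1 * K ^ n)"
    have gG: "norm (g t) \<le> G" if "t \<in> {a..a + h}" for t
      unfolding G_def K_def g_def
      using a h E s that small l0 A unfolding g_def by (intro exp_sum_small_on_interval[where E = E]) auto
    have "G \<le> exp 1 * (M * (1 / 2) ^ n + \<epsilon> * K ^ n)"
    proof -
      have "M * (1 / 2) ^ Suc n \<le> M * (1 / 2) ^ n" using M by (intro mult_left_mono) auto
      also have "\<dots> \<le> exp 1 * (M * (1 / 2) ^ n)"
        using M mult_right_mono[of 1 "exp 1" "M * (1 / 2) ^ n"] by simp
      finally show ?thesis by (simp add: G_def algebra_simps)
    qed
    moreover have "norm (A k) * exp (- l k * a) * (c * exp (- D * (real (Suc k))\<^sup>2)) \<le> Q * G"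
      using a h l0 A(1) gG \<tau>_sum Q P \<kappa> unfolding g_def
      by (intro exp_sum_coeff_bound[where l = l and \<tau> = \<tau> and c = a and h = h]) (auto simp: \<tau>_def)
    moreover have "0 \<le> Q" by (simp add: Q_def)
    ultimately have "norm (A k) * exp (- l k * a) * (c * exp (- D * (real (Suc k))\<^sup>2))
        \<le> Q * (exp 1 * (M * (1 / 2) ^ n + \<epsilon> * K ^ n))"
      by (meson mult_left_mono order_trans)
    then have "norm (A k) * (exp (- l k * a) * exp (- D * (real (Suc k))\<^sup>2)) \<le> C * (M * (1 / 2) ^ n + \<epsilon> * K ^ n)"
      using c by (simp add: C_def field_simps)
    moreover have "exp (- (D' * (real (Suc k))\<^sup>2)) \<le> exp (- l k * a) * exp (- D * (real (Suc k))\<^sup>2)"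
    proof -
      have "l k \<le> (real (Suc k))\<^sup>2"
        unfolding l_def using \<beta> powr_mono[of \<beta> 2 "real (Suc k)"] by (simp add: powr_numeral)
      then have "l k * a + D * (real (Suc k))\<^sup>2 \<le> (real (Suc k))\<^sup>2 * a + \<bar>D\<bar> * (real (Suc k))\<^sup>2"
        using a by (intro add_mono mult_right_mono) auto
      then show ?thesis by (simp add: D'_def algebra_simps flip: exp_add)
    qed
    ultimately have "norm (A k) * exp (- (D' * (real (Suc k))\<^sup>2)) \<le> C * (M * (1 / 2) ^ n + \<epsilon> * K ^ n)"
      by (meson mult_left_mono norm_ge_zero order_trans)
    then have "norm (A k) * exp (- (D' * (real (Suc k))\<^sup>2)) * exp (D' * (real (Suc k))\<^sup>2)
        \<le> C * (M * (1 / 2) ^ n + \<epsilon> * K ^ n) * exp (D' * (real (Suc k))\<^sup>2)"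
      by (rule mult_right_mono) simp
    moreover have "exp (- (D' * (real (Suc k))\<^sup>2)) * exp (D' * (real (Suc k))\<^sup>2) = 1"
      by (simp flip: exp_add)
    ultimately show ?thesis by (simp only: mult.assoc mult_1_right) (simp only: mult_ac)
  qed
  with C D' K show thesis by (rule that)
qed

text \<open>The arithmetic condition on \<open>x0\<close> enters here only: dividing by
  \<open>sin (Suc k * x0)\<close> costs \<open>Suc k / d0\<close>, absorbed by raising
  \<open>D\<close> to \<open>D + 1\<close>.\<close>

lemma sine_coeff_small:
  fixes \<alpha> x0 m d0 :: real and B :: "real set"
  assumes \<alpha>: "1 / 2 < \<alpha>" "\<alpha> < 1"
    and d0: "0 < d0" "\<And>k::nat. 1 \<le> k \<Longrightarrow> d0 * inverse (real k) \<le> \<bar>sin (real k * x0)\<bar>"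
    and B: "B \<in> sets lebesgue" "emeasure lebesgue B > 0" "B \<subseteq> {0..}"
  obtains C D K where "0 < C" "0 < D" "0 < K"
    "\<And>f \<epsilon> k n. f \<in> sine_sobolev 2 \<Longrightarrow> sine_sobolev_norm 2 f \<le> m \<Longrightarrow>
      (AE t in lebesgue_on B. norm (frac_heat_solution \<alpha> f x0 t) \<le> \<epsilon>) \<Longrightarrow>
      norm (sine_coeff f (Suc k)) \<le> C * exp (D * (real (Suc k))\<^sup>2) * ((1 / 2) ^ n + \<epsilon> * K ^ n)"
proof -
  have \<beta>: "1 < 2 * \<alpha>" "2 * \<alpha> < 2" using \<alpha> by auto
  obtain C D K where CDK: "0 < C" "0 < D" "0 < K" and coeff:
    "\<And>A M \<epsilon> k n. summable (\<lambda>k. norm (A k :: complex)) \<Longrightarrow> (\<Sum>k. norm (A k)) \<le> M \<Longrightarrow>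
      (AE t in lebesgue_on B. norm (\<Sum>k. A k * of_real (exp (- (real (Suc k) powr (2 * \<alpha>)) * t))) \<le> \<epsilon>) \<Longrightarrow>
      norm (A k) \<le> C * exp (D * (real (Suc k))\<^sup>2) * (M * (1 / 2) ^ n + \<epsilon> * K ^ n)"
    by (rule exp_sum_coeff_small[OF \<beta> B], rule that)
  \<comment> \<open>The summand 1 gives \<open>M \<ge> 1\<close>, so \<open>M\<close> can be
    factored out of both terms of the coefficient bound.\<close>
  define M where "M = 1 + m\<^sup>2 + (\<Sum>k. 1 / (real (Suc k))\<^sup>2)"
  have inv: "summable (\<lambda>k. 1 / (real (Suc k))\<^sup>2)"
    by (rule summable_inverse_Suc_squares)
  have M1: "1 \<le> M" unfolding M_def using suminf_nonneg[OF inv] by simp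
  have "norm (sine_coeff f (Suc k)) \<le> C * M / d0 * exp ((D + 1) * (real (Suc k))\<^sup>2) * ((1 / 2) ^ n + \<epsilon> * K ^ n)"
    if f: "f \<in> sine_sobolev 2" "sine_sobolev_norm 2 f \<le> m"
      and ae: "AE t in lebesgue_on B. norm (frac_heat_solution \<alpha> f x0 t) \<le> \<epsilon>" for f \<epsilon> k n
  proof -
    note W = sine_sobolev_2_summable[OF f]
    note b = weighted_square_sum_bounds[OF W]
    define A where "A k = sine_coeff f (Suc k) * of_real (sin (real (Suc k) * x0))" for k
    have A_le: "norm (A k) \<le> norm (sine_coeff f (Suc k))" for k
      by (simp add: A_def norm_mult mult_left_le)
    have A: "summable (\<lambda>k. norm (A k))"
      by (rule summable_comparison_test'[OF b(1), of 0]) (simp add: A_le)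
    have "(\<Sum>k. norm (A k)) \<le> (\<Sum>k. norm (sine_coeff f (Suc k)))" by (rule suminf_le[OF A_le A b(1)])
    then have AM: "(\<Sum>k. norm (A k)) \<le> M" using b(2) unfolding M_def by linarith
    have aeA: "AE t in lebesgue_on B. norm (\<Sum>k. A k * of_real (exp (- (real (Suc k) powr (2 * \<alpha>)) * t))) \<le> \<epsilon>"
      using ae
    proof (rule AE_mp, intro AE_I2 impI)
      fix t assume "t \<in> space (lebesgue_on B)" and le: "norm (frac_heat_solution \<alpha> f x0 t) \<le> \<epsilon>"
      then have t: "0 \<le> t" using B(3) by auto
      show "norm (\<Sum>k. A k * of_real (exp (- (real (Suc k) powr (2 * \<alpha>)) * t))) \<le> \<epsilon>"
        using le unfolding frac_heat_solution_suminf[OF b(1) t] A_def .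
    qed
    have \<epsilon>: "0 \<le> \<epsilon>"
    proof (rule ccontr)
      assume "\<not> 0 \<le> \<epsilon>"
      then have "\<not> norm (frac_heat_solution \<alpha> f x0 t) \<le> \<epsilon>" for t
        using norm_ge_zero[of "frac_heat_solution \<alpha> f x0 t"] by linarith
      with ae have "AE t in lebesgue_on B. False" by simp
      then have "emeasure (lebesgue_on B) (space (lebesgue_on B)) = 0"
        unfolding eventually_False ae_filter_eq_bot_iff .
      then show False using B by (simp add: emeasure_restrict_space)
    qed
    define X where "X = real (Suc k)"
    have X: "1 \<le> X" by (simp add: X_def)
    have "norm (A k) \<le> C * exp (D * X\<^sup>2) * (M * (1 / 2) ^ n + \<epsilon> * K ^ n)"
      unfolding X_def by (rule coeff[OF A AM aeA])
    also have "M * (1 / 2) ^ n + \<epsilon> * K ^ n \<le> M * ((1 / 2) ^ n + \<epsilon> * K ^ n)"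
    proof -
      have "1 * (\<epsilon> * K ^ n) \<le> M * (\<epsilon> * K ^ n)" using M1 \<epsilon> CDK by (intro mult_right_mono) auto
      then show ?thesis by (simp add: distrib_left)
    qed
    finally have AMX: "norm (A k) \<le> C * exp (D * X\<^sup>2) * (M * ((1 / 2) ^ n + \<epsilon> * K ^ n))"
      using CDK by (simp add: mult_left_mono)
    have "norm (sine_coeff f (Suc k)) * (d0 * inverse X) \<le> norm (A k)"
      unfolding A_def norm_mult norm_of_real X_def by (intro mult_left_mono d0(2)) auto
    then have "norm (sine_coeff f (Suc k)) \<le> X / d0 * norm (A k)"
      using d0(1) X by (simp add: field_simps)
    also have "\<dots> \<le> exp (X\<^sup>2) / d0 * (C * exp (D * X\<^sup>2) * (M * ((1 / 2) ^ n + \<epsilon> * K ^ n)))"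
    proof (intro mult_mono divide_right_mono AMX)
      have "X \<le> X\<^sup>2" using X by (simp add: power2_eq_square)
      then show "X \<le> exp (X\<^sup>2)" using exp_ge_add_one_self[of "X\<^sup>2"] by linarith
    qed (use d0(1) in auto)
    also have "\<dots> = C * M / d0 * (exp (D * X\<^sup>2) * exp (X\<^sup>2)) * ((1 / 2) ^ n + \<epsilon> * K ^ n)"
      by simp
    also have "exp (D * X\<^sup>2) * exp (X\<^sup>2) = exp ((D + 1) * X\<^sup>2)"
      by (simp add: distrib_right flip: exp_add)
    finally show ?thesis unfolding X_def .
  qed
  moreover have "0 < C * M / d0" "0 < D + 1" using CDK M1 d0 by auto
  ultimately show thesis using that CDK(3) by blast
qed

text \<open>Parseval's sum is split at \<open>N\<close>: the low modes are controlled by the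
  observation, the high ones by the Sobolev bound.\<close>

lemma L2_norm_exponential_tradeoff:
  fixes \<alpha> x0 m d0 :: real and B :: "real set"
  assumes \<alpha>: "1 / 2 < \<alpha>" "\<alpha> < 1"
    and d0: "0 < d0" "\<And>k::nat. 1 \<le> k \<Longrightarrow> d0 * inverse (real k) \<le> \<bar>sin (real k * x0)\<bar>"
    and B: "B \<in> sets lebesgue" "emeasure lebesgue B > 0" "B \<subseteq> {0..}"
    and m: "0 < m"
  obtains C b where "0 < C" "0 < b"
    "\<And>f \<epsilon> N. f \<in> sine_sobolev 2 \<Longrightarrow> sine_sobolev_norm 2 f \<le> m \<Longrightarrow> 0 \<le> \<epsilon> \<Longrightarrow>
      (AE t in lebesgue_on B. norm (frac_heat_solution \<alpha> f x0 t) \<le> \<epsilon>) \<Longrightarrow> 1 \<le> N \<Longrightarrow>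
      L2_norm_on {0<..<pi} f \<le> C * (1 / (real N)\<^sup>2 + \<epsilon> * exp (b * (real N)\<^sup>2))"
proof -
  obtain C D K where CDK: "0 < C" "0 < D" "0 < K" and coeff:
    "\<And>f \<epsilon> k n. f \<in> sine_sobolev 2 \<Longrightarrow> sine_sobolev_norm 2 f \<le> m \<Longrightarrow>
      (AE t in lebesgue_on B. norm (frac_heat_solution \<alpha> f x0 t) \<le> \<epsilon>) \<Longrightarrow>
      norm (sine_coeff f (Suc k)) \<le> C * exp (D * (real (Suc k))\<^sup>2) * ((1 / 2) ^ n + \<epsilon> * K ^ n)"
    by (rule sine_coeff_small[OF \<alpha> d0 B, of m], assumption, rule that)
  \<comment> \<open>In \<open>D + 2\<close>, one unit beyond \<open>D\<close> compensates the factor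
    \<open>exp X\<close> borrowed in \<open>half\<close>, the other leaves
    \<open>exp (- X) \<le> 1 / X\<close>.\<close>
  define p where "p = nat \<lceil>(D + 2) / ln 2\<rceil>"
  \<comment> \<open>\<open>K \<le> exp K\<close> turns \<open>K ^ n\<close> into
    \<open>exp (K * p * N\<^sup>2)\<close>.\<close>
  define b where "b = D + 1 + K * real p"
  have p: "D + 2 \<le> real p * ln 2"
  proof -
    have "(D + 2) / ln 2 \<le> real p" unfolding p_def by (rule real_nat_ceiling_ge)
    then show ?thesis by (simp add: field_simps)
  qed
  have b: "0 < b" using CDK by (simp add: b_def add_pos_nonneg)
  define C' where "C' = sqrt (pi / 2) * (C + m)"
  have C': "0 < C'" using CDK m by (simp add: C'_def)
  have "L2_norm_on {0<..<pi} f \<le> C' * (1 / (real N)\<^sup>2 + \<epsilon> * exp (b * (real N)\<^sup>2))"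
    if f: "f \<in> sine_sobolev 2" "sine_sobolev_norm 2 f \<le> m" and \<epsilon>: "0 \<le> \<epsilon>"
      and ae: "AE t in lebesgue_on B. norm (frac_heat_solution \<alpha> f x0 t) \<le> \<epsilon>" and N: "1 \<le> N" for f \<epsilon> and N :: nat
  proof -
    note W = sine_sobolev_2_summable[OF f]
    note bs = weighted_square_sum_bounds[OF W]
    define X where "X = (real N)\<^sup>2"
    have NX: "real N \<le> X" using N by (simp add: X_def power2_eq_square)
    have X1: "1 \<le> X" using N by (simp add: X_def)
    \<comment> \<open>The interpolation degree is chosen so that \<open>2 ^ (- n)\<close> beats the growth \<open>exp (D * N\<^sup>2)\<close>.\<close>
    define n where "n = p * N\<^sup>2"
    define Y where "Y = 1 / X + \<epsilon> * exp (b * X)"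
    have Y0: "0 \<le> Y" using \<epsilon> X1 by (simp add: Y_def)
    have half: "exp ((D + 1) * X) * (1 / 2) ^ n \<le> 1 / X"
    proof -
      have "(1 / 2 :: real) ^ n = exp (real n * ln (1 / 2))" by (subst exp_of_nat_mult) simp
      also have "real n * ln (1 / 2) = - (real p * ln 2) * X" by (simp add: n_def X_def ln_div)
      finally have "exp ((D + 1) * X) * (1 / 2) ^ n = exp ((D + 1 - real p * ln 2) * X)"
        by (simp add: algebra_simps flip: exp_add)
      also have "\<dots> \<le> exp (- 1 * X)" using p X1 by (intro exp_le_cancel_iff[THEN iffD2] mult_right_mono) auto
      also have "\<dots> = 1 / exp X" by (simp add: exp_minus inverse_eq_divide)
      also have "\<dots> \<le> 1 / X"
      proof (intro divide_left_mono)
        show "X \<le> exp X" using exp_ge_add_one_self[of X] by linarith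
      qed (use X1 in auto)
      finally show ?thesis .
    qed
    have Kn: "exp ((D + 1) * X) * K ^ n \<le> exp (b * X)"
    proof -
      have "K \<le> exp K" using exp_ge_add_one_self[of K] by linarith
      then have "K ^ n \<le> exp K ^ n" using CDK by (intro power_mono) auto
      also have "\<dots> = exp (real n * K)" by (simp add: exp_of_nat_mult)
      finally have "exp ((D + 1) * X) * K ^ n \<le> exp ((D + 1) * X) * exp (real n * K)"
        by (intro mult_left_mono) auto
      also have "\<dots> = exp (b * X)" by (simp add: b_def n_def X_def algebra_simps flip: exp_add)
      finally show ?thesis .
    qed
    \<comment> \<open>The spare factor \<open>exp (- X)\<close> will pay for the number
      \<open>N\<close> of low modes, because \<open>N \<le> exp X\<close>.\<close>
    have head: "norm (sine_coeff f (Suc k)) \<le> C * Y * exp (- X)" if "k < N" for k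
    proof -
      have "norm (sine_coeff f (Suc k)) \<le> C * exp (D * (real (Suc k))\<^sup>2) * ((1 / 2) ^ n + \<epsilon> * K ^ n)"
        by (rule coeff[OF f ae])
      also have "\<dots> \<le> C * exp (D * X) * ((1 / 2) ^ n + \<epsilon> * K ^ n)"
      proof -
        have "(real (Suc k))\<^sup>2 \<le> X" unfolding X_def using that by (intro power_mono) auto
        then show ?thesis using CDK \<epsilon> by (intro mult_right_mono mult_left_mono) auto
      qed
      also have "\<dots> = C * (exp ((D + 1) * X) * (1 / 2) ^ n + \<epsilon> * (exp ((D + 1) * X) * K ^ n)) * exp (- X)"
      proof -
        have "exp (D * X) = exp ((D + 1) * X) * exp (- X)" by (simp add: algebra_simps flip: exp_add)
        then show ?thesis by (simp add: algebra_simps)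
      qed
      also have "\<dots> \<le> C * (1 / X + \<epsilon> * exp (b * X)) * exp (- X)"
        using half Kn \<epsilon> CDK by (intro mult_right_mono mult_left_mono add_mono) auto
      finally show ?thesis unfolding Y_def .
    qed
    have "(\<Sum>k<N. (norm (sine_coeff f (Suc k)))\<^sup>2) \<le> (\<Sum>k<N. (C * Y)\<^sup>2 * exp (- X))"
    proof (intro sum_mono)
      fix k assume "k \<in> {..<N}"
      then have "(norm (sine_coeff f (Suc k)))\<^sup>2 \<le> (C * Y * exp (- X))\<^sup>2"
        using head by (intro power_mono) auto
      also have "\<dots> = (C * Y)\<^sup>2 * (exp (- X))\<^sup>2" by (simp only: power_mult_distrib)
      also have "(exp (- X))\<^sup>2 \<le> exp (- X)" using X1 by (simp add: power2_eq_square mult_left_le)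
      finally show "(norm (sine_coeff f (Suc k)))\<^sup>2 \<le> (C * Y)\<^sup>2 * exp (- X)" by (simp add: mult_left_mono)
    qed
    also have "\<dots> = (C * Y)\<^sup>2 * (real N * exp (- X))" by simp
    also have "\<dots> \<le> (C * Y)\<^sup>2 * 1"
    proof (intro mult_left_mono)
      have "real N \<le> exp X" using NX exp_ge_add_one_self[of X] by linarith
      then show "real N * exp (- X) \<le> 1" by (simp add: exp_minus field_simps)
    qed auto
    finally have headsum: "(\<Sum>k<N. (norm (sine_coeff f (Suc k)))\<^sup>2) \<le> (C * Y)\<^sup>2" by simp
    have tailsum: "(\<Sum>k. (norm (sine_coeff f (Suc (k + N))))\<^sup>2) \<le> (m / X)\<^sup>2"
      using bs(3)[OF N] unfolding X_def .
    have pars: "(\<lambda>k. (norm (sine_coeff f (Suc k)))\<^sup>2) sums (2 / pi * (L2_norm_on {0<..<pi} f)\<^sup>2)"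
      using f by (intro sine_parseval bs(1)) (simp add: sine_sobolev_def)
    have "2 / pi * (L2_norm_on {0<..<pi} f)\<^sup>2
        = (\<Sum>k. (norm (sine_coeff f (Suc (k + N))))\<^sup>2) + (\<Sum>k<N. (norm (sine_coeff f (Suc k)))\<^sup>2)"
      using suminf_split_initial_segment[OF sums_summable[OF pars], of N] sums_unique[OF pars] by simp
    also have "\<dots> \<le> (m / X)\<^sup>2 + (C * Y)\<^sup>2" using headsum tailsum by linarith
    also have "\<dots> \<le> (m / X + C * Y)\<^sup>2"
      using m X1 CDK Y0 by (simp add: power2_sum)
    also have "\<dots> \<le> ((C + m) * Y)\<^sup>2"
    proof (intro power_mono)
      have "m * (1 / X) \<le> m * Y" using m \<epsilon> by (intro mult_left_mono) (auto simp: Y_def)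
      then show "m / X + C * Y \<le> (C + m) * Y" by (simp add: algebra_simps)
    qed (use m X1 CDK Y0 in auto)
    finally have "(L2_norm_on {0<..<pi} f)\<^sup>2 \<le> pi / 2 * ((C + m) * Y)\<^sup>2"
      by (simp add: field_simps)
    then have "L2_norm_on {0<..<pi} f \<le> sqrt (pi / 2 * ((C + m) * Y)\<^sup>2)" by (rule real_le_rsqrt)
    also have "\<dots> = C' * Y"
      unfolding C'_def real_sqrt_mult[of "pi / 2"] real_sqrt_abs using CDK m Y0 by simp
    finally show ?thesis unfolding Y_def X_def .
  qed
  with C' b show thesis by (rule that)
qed

theorem theorem3p2:
  fixes \<alpha> x0 m :: real and B :: "real set"
  assumes "1 / 2 < \<alpha>" and "\<alpha> < 1"
    and "x0 \<in> {0<..<pi}"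
    and "\<exists>d0>0. \<forall>k::nat. k \<ge> 1 \<longrightarrow> \<bar>sin (real k * x0)\<bar> \<ge> d0 * inverse (real k)"
    and "\<exists>T>0. B \<subseteq> {0..T}"
    and "B \<in> sets lebesgue" and "emeasure lebesgue B > 0"
    and "m > 0"
  shows "\<exists>C::real. C > 0 \<and>
    (\<forall>f \<in> sine_sobolev 2. sine_sobolev_norm 2 f \<le> m \<longrightarrow>
       ennreal (L2_norm_on {0<..<pi} f) \<le>
         ennreal C * (inverse_abs_ln (Linf_norm_on B (frac_heat_solution \<alpha> f x0))
                      + Linf_norm_on B (frac_heat_solution \<alpha> f x0)))"
proof -
  obtain d0 where d0: "0 < d0" "\<And>k::nat. 1 \<le> k \<Longrightarrow> d0 * inverse (real k) \<le> \<bar>sin (real k * x0)\<bar>"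
    using assms(4) by blast
  have B0: "B \<subseteq> {0..}" using assms(5) by auto
  obtain C b where Cb: "0 < C" "0 < b" and tradeoff:
    "\<And>f \<epsilon> N. f \<in> sine_sobolev 2 \<Longrightarrow> sine_sobolev_norm 2 f \<le> m \<Longrightarrow> 0 \<le> \<epsilon> \<Longrightarrow>
      (AE t in lebesgue_on B. norm (frac_heat_solution \<alpha> f x0 t) \<le> \<epsilon>) \<Longrightarrow> 1 \<le> N \<Longrightarrow>
      L2_norm_on {0<..<pi} f \<le> C * (1 / (real N)\<^sup>2 + \<epsilon> * exp (b * (real N)\<^sup>2))"
    by (rule L2_norm_exponential_tradeoff[OF assms(1,2) d0 assms(6,7) B0 assms(8)], assumption, rule that)
  obtain C' where C': "0 < C'" and log_rate:
    "\<And>y \<epsilon>. 0 \<le> \<epsilon> \<Longrightarrow> (\<And>N::nat. 1 \<le> N \<Longrightarrow> y \<le> C * (1 / (real N)\<^sup>2 + \<epsilon> * exp (b * (real N)\<^sup>2))) \<Longrightarrow>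
      y \<le> (if \<epsilon> = 0 then 0 else C' * (1 / \<bar>ln \<epsilon>\<bar> + \<epsilon>))"
    using log_rate_of_exponential_tradeoff[OF Cb] by auto
  have "ennreal (L2_norm_on {0<..<pi} f) \<le>
      ennreal C' * (inverse_abs_ln (Linf_norm_on B (frac_heat_solution \<alpha> f x0)) + Linf_norm_on B (frac_heat_solution \<alpha> f x0))"
    if f: "f \<in> sine_sobolev 2" "sine_sobolev_norm 2 f \<le> m" for f
  proof (cases "Linf_norm_on B (frac_heat_solution \<alpha> f x0)")
    case top
    then show ?thesis using C' by (simp add: ennreal_mult_top)
  next
    case (real \<epsilon>)
    have "AE t in lebesgue_on B. ennreal (norm (frac_heat_solution \<alpha> f x0 t)) \<le> ennreal \<epsilon>"
      using esssup_AE[of "\<lambda>t. ennreal (norm (frac_heat_solution \<alpha> f x0 t))" "lebesgue_on B"] real(2)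
      by (simp add: Linf_norm_on_def)
    then have ae: "AE t in lebesgue_on B. norm (frac_heat_solution \<alpha> f x0 t) \<le> \<epsilon>"
      using real(1) by simp
    have main: "L2_norm_on {0<..<pi} f \<le> (if \<epsilon> = 0 then 0 else C' * (1 / \<bar>ln \<epsilon>\<bar> + \<epsilon>))"
      using log_rate[OF real(1)] tradeoff[OF f real(1) ae] by blast
    show ?thesis
    \<comment> \<open>Here \<open>inverse_abs_ln\<close> is 0 as well, so \<open>f\<close> must have
      norm zero exactly; \<open>main\<close> provides this.\<close>
    proof (cases "\<epsilon> = 0")
      case True
      then show ?thesis using main by (simp add: ennreal_neg)
    next
      case False
      then have pos: "0 < \<epsilon>" using real(1) by simp
      have "ennreal (1 / \<bar>ln \<epsilon>\<bar>) \<le> inverse_abs_ln (ennreal \<epsilon>)"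
        \<comment> \<open>At \<open>\<epsilon> = 1\<close> the real quotient is
          \<open>1 / 0 = 0\<close> while \<open>inverse_abs_ln\<close> is infinite, so only an
          inequality holds, in the direction needed.\<close>
        using pos by (cases "ln \<epsilon> = 0") (auto simp: inverse_abs_ln_def inverse_ennreal inverse_eq_divide)
      then have "ennreal C' * (ennreal (1 / \<bar>ln \<epsilon>\<bar>) + ennreal \<epsilon>) \<le> ennreal C' * (inverse_abs_ln (ennreal \<epsilon>) + ennreal \<epsilon>)"
        by (intro mult_left_mono add_right_mono) auto
      moreover have "ennreal C' * (ennreal (1 / \<bar>ln \<epsilon>\<bar>) + ennreal \<epsilon>) = ennreal (C' * (1 / \<bar>ln \<epsilon>\<bar> + \<epsilon>))"
        using C' pos by (simp add: ennreal_mult ennreal_plus)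
      moreover have "ennreal (L2_norm_on {0<..<pi} f) \<le> ennreal (C' * (1 / \<bar>ln \<epsilon>\<bar> + \<epsilon>))"
        using main False by (intro ennreal_leI) simp
      ultimately show ?thesis unfolding real(2) by simp
    qed
  qed
  then show ?thesis using C' by blast
qed

end
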